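(* Let $G$ be a layer-complete directed graph with nonempty layers $0,\dots,k$ ($k\ge1$), with a planar presentation as described in the context. Then the non-crossing comb-trees of $G$ induce a triangulation of the root polytope $\mathcal{Q}_G$: the simplices $\mathcal{Q}_T$, for $T$ a non-crossing comb-tree, are maximal dimensional simplices with mutually disjoint interiors whose union is $\mathcal{Q}_G$, and any two of them intersect in a (possibly empty) common face.
   Context: A directed graph is an orientation of a finite graph without loops and multiple edges; $\overrightarrow{th}$ denotes an edge with tail $t$ and head $h$. Connectedness, cycles and spanning trees are meant in the underlying undirected graph. A directed graph is semi-balanced if each of its cycles has the same number of edges going in the two directions; a layering is a function $l:V(G)\to\mathbf{Z}$ with $l(h)-l(t)=1$ for each edge $\overrightarrow{th}$. A layer-complete directed graph is a connected semi-balanced graph $G$ with a layering $l$ such that for each $i\in\mathbf{Z}$ with $l^{-1}(i)\ne\varnothing$ and $l^{-1}(i+1)\neq\varnothing$, there is a complete bipartite subgraph between $l^{-1}(i)$ and $l^{-1}(i+1)$, with all edges oriented from $l^{-1}(i)$ to $l^{-1}(i+1)$. Suppose the nonempty layers are $l^{-1}(0),\dots,l^{-1}(k)$, and denote $l^{-1}(i)=\{x_{i,0},\dots,x_{i,s_i}\}$. Planar presentation: draw $x_{i,0},\dots,x_{i,s_i}$ in this order from left to right on the horizontal line with second coordinate $i$, and draw all edges as straight line segments. A non-crossing tree of a complete bipartite graph drawn between two horizontal lines is a spanning tree whose edges do not cross each other in the drawing. A spanning tree $T$ of $G$ is a non-crossing comb-tree if for each layer $0\le i\le k$ there is a partition $l^{-1}(i)-\{x_{i,0}\}=D_i\sqcup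 U_i$, with $D_0=\varnothing$ and $U_k=\varnothing$, such that $T=T_1\cup\dots\cup T_k$ where $T_i$ is a non-crossing tree of the complete bipartite graph with vertex classes $\{x_{i-1,0}\}\cup U_{i-1}$ and $\{x_{i,0}\}\cup D_i$. For $G=(V,E)$ let $\mathbf{v}\in\mathbf{R}^V$ be the standard basis vector of $v\in V$. The root polytope is $\mathcal{Q}_G=\mathrm{Conv}\{\mathbf{h}-\mathbf{t}\mid \overrightarrow{th}\in E\}$; for a spanning tree $T$, $\mathcal{Q}_T=\mathrm{Conv}\{\mathbf{h}-\mathbf{t}\mid \overrightarrow{th}\in T\}$. Interiors are relative to the affine hull of $\mathcal{Q}_G$. *)

theory Defs
  imports "HOL-Analysis.Analysis"
begin

text \<open>
  The pair (t, h) is the edge with tail t and head h. The vertex set of the graph G is a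
  whole finite type 'v, so that R^V is the type real^'v; a directed graph G is then just its
  edge set. It is an orientation of a graph without loops and multiple edges iff its edge
  relation is asymmetric (asymmetry excludes loops as well as pairs of opposite edges).

  Connectedness, cycles and trees are those of the underlying undirected graph. They take an
  explicit vertex set where they are also needed for subgraphs on fewer vertices.
\<close>

type_synonym 'v edges = "('v \<times> 'v) set"

definition adjacent :: "'v edges \<Rightarrow> 'v \<Rightarrow> 'v \<Rightarrow> bool" where
  "adjacent E u v \<longleftrightarrow> (u, v) \<in> E \<or> (v, u) \<in> E"

definition connected_graph :: "'v set \<Rightarrow> 'v edges \<Rightarrow> bool" where
  "connected_graph V E \<longleftrightarrow>
     V \<noteq> {} \<and> E \<subseteq> V \<times> V \<and> (\<forall>u\<in>V. \<forall>v\<in>V. (adjacent E)\<^sup>*\<^sup>* u v)"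

text \<open>
  A cycle is given by the list of its vertices in cyclic order, without repeating the first one.
\<close>

definition cycle_next :: "'v list \<Rightarrow> nat \<Rightarrow> 'v" where
  "cycle_next p i = p ! (Suc i mod length p)"

definition graph_cycle :: "'v edges \<Rightarrow> 'v list \<Rightarrow> bool" where
  "graph_cycle E p \<longleftrightarrow>
     3 \<le> length p \<and> distinct p \<and> (\<forall>i<length p. adjacent E (p ! i) (cycle_next p i))"

definition semi_balanced :: "'v edges \<Rightarrow> bool" where
  "semi_balanced E \<longleftrightarrow>
     (\<forall>p. graph_cycle E p \<longrightarrow>
        card {i. i < length p \<and> (p ! i, cycle_next p i) \<in> E} =
        card {i. i < length p \<and> (cycle_next p i, p ! i) \<in> E})"

definition layering :: "'v edges \<Rightarrow> ('v \<Rightarrow> int) \<Rightarrow> bool" where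
  "layering E l \<longleftrightarrow> (\<forall>(t, h)\<in>E. l h - l t = 1)"

definition layer :: "('v \<Rightarrow> int) \<Rightarrow> int \<Rightarrow> 'v set" where
  "layer l i = l -` {i}"

definition layer_complete :: "'v edges \<Rightarrow> ('v \<Rightarrow> int) \<Rightarrow> bool" where
  "layer_complete E l \<longleftrightarrow>
     asym E \<and> connected_graph UNIV E \<and> semi_balanced E \<and> layering E l \<and>
     (\<forall>i. layer l i \<noteq> {} \<and> layer l (i + 1) \<noteq> {} \<longrightarrow> layer l i \<times> layer l (i + 1) \<subseteq> E)"

definition spanning_tree :: "'v set \<Rightarrow> 'v edges \<Rightarrow> 'v edges \<Rightarrow> bool" where
  "spanning_tree V E T \<longleftrightarrow> T \<subseteq> E \<and> connected_graph V T \<and> (\<nexists>p. graph_cycle T p)"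

text \<open>
  The vertices of layer i are x i 0, ..., x i (s i), and pos assigns to each vertex its point
  in the plane. The horizontal coordinates are arbitrary, subject to the left-to-right order.
\<close>

definition planar_presentation ::
  "('v \<Rightarrow> int) \<Rightarrow> nat \<Rightarrow> (nat \<Rightarrow> nat) \<Rightarrow> (nat \<Rightarrow> nat \<Rightarrow> 'v) \<Rightarrow> ('v \<Rightarrow> real \<times> real) \<Rightarrow> bool" where
  "planar_presentation l k s x pos \<longleftrightarrow>
     (\<forall>i\<le>k. bij_betw (x i) {0..s i} (layer l (int i)) \<and>
            (\<forall>j\<le>s i. snd (pos (x i j)) = real i) \<and>
            (\<forall>j j'. j < j' \<and> j' \<le> s i \<longrightarrow> fst (pos (x i j)) < fst (pos (x i j'))))"

text \<open>
  Open segments are used so that edges sharing an endpoint do not count as crossing there.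
\<close>

definition edges_cross :: "('v \<Rightarrow> real \<times> real) \<Rightarrow> 'v \<times> 'v \<Rightarrow> 'v \<times> 'v \<Rightarrow> bool" where
  "edges_cross pos e f \<longleftrightarrow>
     e \<noteq> f \<and>
     open_segment (pos (fst e)) (pos (snd e)) \<inter> open_segment (pos (fst f)) (pos (snd f)) \<noteq> {}"

text \<open>
  The complete bipartite graph with vertex classes A (lower line) and B (upper line), oriented
  upwards, has edge set A \<open>\<times>\<close> B.
\<close>

definition noncrossing_tree ::
  "('v \<Rightarrow> real \<times> real) \<Rightarrow> 'v set \<Rightarrow> 'v set \<Rightarrow> 'v edges \<Rightarrow> bool" where
  "noncrossing_tree pos A B T \<longleftrightarrow>
     spanning_tree (A \<union> B) (A \<times> B) T \<and> (\<forall>e\<in>T. \<forall>f\<in>T. \<not> edges_cross pos e f)"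

definition noncrossing_comb_tree ::
  "'v edges \<Rightarrow> ('v \<Rightarrow> int) \<Rightarrow> nat \<Rightarrow> (nat \<Rightarrow> nat \<Rightarrow> 'v) \<Rightarrow> ('v \<Rightarrow> real \<times> real) \<Rightarrow> 'v edges \<Rightarrow> bool"
where
  "noncrossing_comb_tree E l k x pos T \<longleftrightarrow>
     spanning_tree UNIV E T \<and>
     (\<exists>D U S. (\<forall>i\<le>k. D i \<union> U i = layer l (int i) - {x i 0} \<and> D i \<inter> U i = {}) \<and>
        D 0 = {} \<and> U k = {} \<and>
        (\<forall>i\<in>{1..k}. noncrossing_tree pos
           ({x (i - 1) 0} \<union> U (i - 1)) ({x i 0} \<union> D i) (S i)) \<and>
        T = (\<Union>i\<in>{1..k}. S i))"

definition root_polytope :: "('v::finite) edges \<Rightarrow> (real ^ 'v) set" where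
  "root_polytope E = convex hull {axis h 1 - axis t 1 | t h. (t, h) \<in> E}"

end

theory Submission
  imports Defs
begin

text \<open>
  A point of the root polytope is the vector of net inflows of a nonnegative flow of total amount 1,
  and a point of \<open>root_polytope T\<close> comes from such a flow that uses the edges of \<open>T\<close> only. The
  theorem amounts to two statements: every flow can be rerouted through a comb-tree without changing
  its net inflows (\<open>comb_tree_through_flow\<close>), and flows on comb-trees with equal net
  inflows are equal, even if the trees differ (\<open>comb_tree_flow_unique\<close>).

  Both rest on the observation that in a comb-tree the net inflows \<open>y\<close> dictate the inflow and the
  outflow of each vertex. A vertex that is not first in its layer has edges on one side only, so its
  inflow is the positive part of its net inflow. The total amount that enters layer \<open>i\<close> is the sum
  of \<open>y\<close> over the layers from \<open>i\<close> upwards, and the first vertex of the layer takes what the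
  others leave. Between consecutive layers there remains a transport problem with prescribed
  marginals on two ordered sets. Non-crossing means that the transport is monotone, which makes it
  unique (\<open>monotone_plan_unique\<close>), and the north-west corner rule finds it on a non-crossing
  spanning tree (\<open>northwest_corner_tree\<close>).

  The geometry follows. The edge vectors of a spanning tree are linearly independent and span the
  same affine space as those of the whole graph, which gives full-dimensional simplices. By
  uniqueness, two of the simplices meet in the simplex of the common edges
  (\<open>unique_flows_common_face\<close>), a face of both; for different trees it is a proper face of at
  least one of them, so it misses the interior of that one.

  Trees are handled through edge potentials: a graph is acyclic iff for each edge there is a function
  on the vertices that increases by 1 along this edge and is constant along all others.
\<close>

section \<open>Edge potentials and gluing of trees\<close>

lemma adjacent_mono: "F \<subseteq> F' \<Longrightarrow> adjacent F u v \<Longrightarrow> adjacent F' u v"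
  by (auto simp: adjacent_def)

lemma reachable_mono: "F \<subseteq> F' \<Longrightarrow> (adjacent F)\<^sup>*\<^sup>* u v \<Longrightarrow> (adjacent F')\<^sup>*\<^sup>* u v"
  by (metis adjacent_mono mono_rtranclp)

lemma simple_path_exists:
  assumes "(adjacent F)\<^sup>*\<^sup>* u v"
  shows "\<exists>p. distinct p \<and> p \<noteq> [] \<and> hd p = u \<and> last p = v \<and> successively (adjacent F) p"
  using assms
proof (induction rule: rtranclp_induct)
  case base
  show ?case by (rule exI[of _ "[u]"]) simp
next
  case (step y z)
  then obtain p where p: "distinct p" "p \<noteq> []" "hd p = u" "last p = y"
    "successively (adjacent F) p" by blast
  show ?case
  proof (cases "z \<in> set p")
    case False
    then show ?thesis
      using p step.hyps(2) by (intro exI[of _ "p @ [z]"]) (auto simp: successively_append_iff)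
  next
    case True
    then obtain q r where "p = q @ z # r" by (meson split_list)
    with p show ?thesis
      by (intro exI[of _ "q @ [z]"]) (auto simp: successively_append_iff hd_append split: if_splits)
  qed
qed

text \<open>
  In an acyclic graph every edge is a bridge: a simple path joining its endpoints in the rest of
  the graph would close up to a cycle. The indicator function of the component of the head, once
  the edge is removed, therefore jumps along this edge only. Asymmetry guarantees that the cycle
  has at least three vertices. Such potentials serve twice: they are dual to the edge vectors, which
  yields linear independence, and together with the converse below they make it possible to
  recognize trees without handling cycles.
\<close>

lemma edge_potential_if_acyclic:
  assumes "asym T" "\<nexists>p. graph_cycle T p" and e: "(t, h) \<in> T"
  shows "\<exists>f::'v \<Rightarrow> real. f h - f t = 1 \<and> (\<forall>(t', h')\<in>T - {(t, h)}. f h' = f t')"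
proof -
  let ?F = "T - {(t, h)}"
  let ?R = "(adjacent ?F)\<^sup>*\<^sup>* h"
  have ne: "(h, t) \<notin> T" "h \<noteq> t" using assms(1) e by (auto dest: asymD)
  have "\<not> ?R t"
  proof
    assume "?R t"
    then obtain p where p: "distinct p" "p \<noteq> []" "hd p = h" "last p = t"
      "successively (adjacent ?F) p" using simple_path_exists by metis
    have ends: "p ! 0 = h" "p ! (length p - 1) = t"
      using p by (auto simp: hd_conv_nth last_conv_nth)
    have adj: "adjacent ?F (p ! i) (p ! Suc i)" if "Suc i < length p" for i
      using p(5) that by (simp add: successively_conv_nth)
    have "length p \<noteq> 0" "length p \<noteq> 1" using p(2) ends ne by auto
    moreover have "length p \<noteq> 2" using adj[of 0] ends ne by (auto simp: adjacent_def)
    ultimately have len: "3 \<le> length p" by linarith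
    have "adjacent T (p ! i) (cycle_next p i)" if "i < length p" for i
    proof (cases "Suc i < length p")
      case True
      then show ?thesis using adj[of i] by (auto simp: cycle_next_def intro: adjacent_mono[rotated])
    next
      case False
      then have "i = length p - 1" "Suc i = length p" using that by auto
      then show ?thesis using ends e by (simp add: cycle_next_def adjacent_def)
    qed
    with len p(1) have "graph_cycle T p" by (simp add: graph_cycle_def)
    with assms(2) show False by blast
  qed
  moreover have "?R h' \<longleftrightarrow> ?R t'" if "(t', h') \<in> ?F" for t' h'
    using that by (meson adjacent_def rtranclp.rtrancl_into_rtrancl)
  ultimately show ?thesis
    by (intro exI[of _ "\<lambda>v. if ?R v then 1 else 0"]) auto
qed

text \<open>
  Walking once around a cycle, the potential of one of its edges stays constant along all the
  other edges, so it cannot change along that edge.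
\<close>

lemma acyclic_if_edge_potentials:
  fixes T :: "'v edges"
  assumes pot: "\<And>t h. (t, h) \<in> T \<Longrightarrow>
      \<exists>f::'v \<Rightarrow> real. f h - f t = 1 \<and> (\<forall>(t', h')\<in>T - {(t, h)}. f h' = f t')"
  shows "\<nexists>p. graph_cycle T p"
proof
  assume "\<exists>p. graph_cycle T p"
  then obtain p where p: "3 \<le> length p" "distinct p"
    and adj: "\<And>i. i < length p \<Longrightarrow> adjacent T (p ! i) (cycle_next p i)"
    by (auto simp: graph_cycle_def)
  let ?n = "length p"
  have "adjacent T (p ! (?n - 1)) (p ! 0)"
    using adj[of "?n - 1"] p(1) by (cases ?n) (auto simp: cycle_next_def)
  then obtain t h where th: "(t, h) \<in> T"
    and ends: "{t, h} = {p ! 0, p ! (?n - 1)}" unfolding adjacent_def by blast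
  obtain f :: "'v \<Rightarrow> real" where f1: "f h - f t = 1"
    and f0: "\<And>t' h'. (t', h') \<in> T \<Longrightarrow> (t', h') \<noteq> (t, h) \<Longrightarrow> f h' = f t'"
    using pot[OF th] by blast
  have "0 < ?n" using p(1) by linarith
  have "f (p ! i) = f (p ! 0)" if "i < ?n" for i
    using that
  proof (induction i)
    case (Suc i)
    have "{p ! i, p ! Suc i} \<noteq> {t, h}"
    proof -
      have inj: "p ! a = p ! b \<longleftrightarrow> a = b" if "a < ?n" "b < ?n" for a b
        using p(2) that by (simp add: nth_eq_iff_index_eq)
      have "?n - 1 < ?n" "i < ?n" using p(1) Suc.prems by linarith+
      then show ?thesis
        unfolding ends doubleton_eq_iff
        using inj[of i 0] inj[of "Suc i" "?n - 1"] inj[of i "?n - 1"] Suc.prems p(1) by linarith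
    qed
    moreover have "adjacent T (p ! i) (p ! Suc i)"
      using adj[of i] Suc.prems by (simp add: cycle_next_def)
    ultimately have "f (p ! Suc i) = f (p ! i)"
      unfolding adjacent_def using f0[of "p ! i" "p ! Suc i"] f0[of "p ! Suc i" "p ! i"]
      by (auto simp: doubleton_eq_iff)
    then show ?case using Suc by simp
  qed simp
  from this[of "?n - 1"] have "f (p ! (?n - 1)) = f (p ! 0)" using p(1) by simp
  then have "f h = f t" using ends by (auto simp: doubleton_eq_iff)
  with f1 show False by simp
qed

lemma connected_graph_glue:
  assumes T: "connected_graph V T" and T': "connected_graph V' T'" and r: "r \<in> V" "r \<in> V'"
  shows "connected_graph (V \<union> V') (T \<union> T')"
proof -
  let ?R = "(adjacent (T \<union> T'))\<^sup>*\<^sup>*"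
  have "?R u r \<and> ?R r u" if "u \<in> V \<union> V'" for u
  proof (cases "u \<in> V")
    case True
    with T r show ?thesis unfolding connected_graph_def
      by (meson reachable_mono Un_upper1)
  next
    case False
    with that T' r show ?thesis unfolding connected_graph_def
      by (meson reachable_mono Un_upper2 UnE)
  qed
  then have "?R u v" if "u \<in> V \<union> V'" "v \<in> V \<union> V'" for u v
    using that by (meson rtranclp_trans)
  with assms show ?thesis unfolding connected_graph_def by blast
qed

lemma edge_potential_glue:
  fixes T T' :: "'v edges" and g :: "'v \<Rightarrow> real"
  assumes V: "T \<subseteq> V \<times> V" "T' \<subseteq> V' \<times> V'" "V \<inter> V' = {r}"
    and g: "g h - g t = 1" "\<forall>(t', h')\<in>T - {(t, h)}. g h' = g t'" and th: "(t, h) \<in> T"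
  shows "\<exists>f::'v \<Rightarrow> real. f h - f t = 1 \<and> (\<forall>(t', h')\<in>T \<union> T' - {(t, h)}. f h' = f t')"
proof -
  define f where "f v = (if v \<in> V then g v else g r)" for v
  have V'_const: "f v = g r" if "v \<in> V'" for v using that V(3) by (auto simp: f_def)
  have "f h' = f t'" if "(t', h') \<in> T" "(t', h') \<noteq> (t, h)" for t' h'
  proof -
    have "t' \<in> V" "h' \<in> V" "g h' = g t'" using that V(1) g(2) by auto
    then show ?thesis by (simp add: f_def)
  qed
  moreover have "f h' = f t'" if "(t', h') \<in> T'" for t' h'
  proof -
    have "t' \<in> V'" "h' \<in> V'" using that V(2) by auto
    then show ?thesis by (simp add: V'_const)
  qed
  moreover have "f h - f t = 1" using g(1) th V(1) by (auto simp: f_def)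
  ultimately show ?thesis by blast
qed

text \<open>
  Trees with exactly one common vertex form a tree: the potential of an edge extends to the other
  tree by its value at the common vertex. With a single edge as the second tree, this attaches a
  leaf.
\<close>

lemma spanning_tree_glue:
  assumes E: "asym E" and T: "spanning_tree V E T" and T': "spanning_tree V' E T'"
    and r: "V \<inter> V' = {r}"
  shows "spanning_tree (V \<union> V') E (T \<union> T')"
proof -
  have asym: "asym T" "asym T'"
    using E T T' unfolding spanning_tree_def by (auto intro: asym_on_subset asymI dest: asymD)
  have V: "T \<subseteq> V \<times> V" "T' \<subseteq> V' \<times> V'" and acyc: "\<nexists>p. graph_cycle T p" "\<nexists>p. graph_cycle T' p"
    using T T' by (auto simp: spanning_tree_def connected_graph_def)
  have "\<nexists>p. graph_cycle (T \<union> T') p"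
  proof (rule acyclic_if_edge_potentials)
    fix t h assume "(t, h) \<in> T \<union> T'"
    then consider "(t, h) \<in> T" | "(t, h) \<in> T'" by blast
    then show "\<exists>f::'a \<Rightarrow> real. f h - f t = 1 \<and> (\<forall>(t', h')\<in>T \<union> T' - {(t, h)}. f h' = f t')"
    proof cases
      case 1
      from edge_potential_if_acyclic[OF asym(1) acyc(1) this] edge_potential_glue[OF V r] 1
      show ?thesis by blast
    next
      case 2
      from r have r': "V' \<inter> V = {r}" by blast
      from edge_potential_if_acyclic[OF asym(2) acyc(2) 2]
        edge_potential_glue[OF V(2,1) r'] 2
      have "\<exists>f::'a \<Rightarrow> real. f h - f t = 1 \<and> (\<forall>(t', h')\<in>T' \<union> T - {(t, h)}. f h' = f t')" by blast
      then show ?thesis by (simp add: Un_commute)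
    qed
  qed
  moreover have "connected_graph (V \<union> V') (T \<union> T')"
    using T T' r by (auto simp: spanning_tree_def intro!: connected_graph_glue)
  ultimately show ?thesis using T T' by (auto simp: spanning_tree_def)
qed

lemma spanning_tree_mono: "spanning_tree V E T \<Longrightarrow> E \<subseteq> E' \<Longrightarrow> spanning_tree V E' T"
  by (auto simp: spanning_tree_def)

lemma spanning_tree_singleton: "spanning_tree {r} E {}"
proof -
  have "\<not> graph_cycle {} p" for p :: "'a list"
    by (cases p) (auto simp: graph_cycle_def adjacent_def)
  then show ?thesis by (auto simp: spanning_tree_def connected_graph_def)
qed

lemma spanning_tree_single_edge:
  assumes "u \<noteq> v" "(u, v) \<in> E"
  shows "spanning_tree {u, v} E {(u, v)}"
proof -
  have "\<nexists>p. graph_cycle {(u, v)} p"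
  proof (rule acyclic_if_edge_potentials)
    fix t h assume "(t, h) \<in> {(u, v)}"
    then show "\<exists>f::'a \<Rightarrow> real. f h - f t = 1 \<and> (\<forall>(t', h')\<in>{(u, v)} - {(t, h)}. f h' = f t')"
      using assms by (intro exI[of _ "\<lambda>w. if w = v then 1 else 0"]) auto
  qed
  moreover have "adjacent {(u, v)} u v" "adjacent {(u, v)} v u" by (auto simp: adjacent_def)
  ultimately show ?thesis using assms(2)
    by (auto simp: spanning_tree_def connected_graph_def)
qed

section \<open>Root polytopes as sets of flows\<close>

definition edge_vector :: "'v::finite \<times> 'v \<Rightarrow> real ^ 'v" where
  "edge_vector e = axis (snd e) 1 - axis (fst e) 1"

definition net_inflow :: "('v::finite \<times> 'v \<Rightarrow> real) \<Rightarrow> real ^ 'v" where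
  "net_inflow c = (\<Sum>e\<in>UNIV. c e *\<^sub>R edge_vector e)"

text \<open>
  A point of \<open>root_polytope T\<close> is the vector of net inflows of a nonnegative flow of total
  amount 1 on the edges of \<open>T\<close>.
\<close>

definition flow_on :: "('v::finite) edges \<Rightarrow> ('v \<times> 'v \<Rightarrow> real) \<Rightarrow> bool" where
  "flow_on T c \<longleftrightarrow> (\<forall>e. 0 \<le> c e) \<and> (\<forall>e. e \<notin> T \<longrightarrow> c e = 0)"

lemma edge_vector_nth:
  "edge_vector e $ v = (if snd e = v then 1 else 0) - (if fst e = v then 1 else 0)"
  by (auto simp: edge_vector_def axis_def)

lemma sum_potential_edge_vector: "(\<Sum>v\<in>UNIV. f v * edge_vector e $ v) = f (snd e) - f (fst e)"
  by (simp add: edge_vector_nth right_diff_distrib sum_subtractf if_distrib[of "times _"] cong: if_cong)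

text \<open>
  Summation by parts; it lets every linear functional on the space of vectors be evaluated edge
  by edge.
\<close>

lemma sum_potential_net_inflow:
  "(\<Sum>v\<in>UNIV. f v * net_inflow c $ v) = (\<Sum>e\<in>UNIV. c e * (f (snd e) - f (fst e)))"
proof -
  have "(\<Sum>v\<in>UNIV. f v * net_inflow c $ v) =
      (\<Sum>v\<in>UNIV. \<Sum>e\<in>UNIV. c e * (f v * edge_vector e $ v))"
    by (simp add: net_inflow_def sum_distrib_left mult_ac)
  also have "\<dots> = (\<Sum>e\<in>UNIV. c e * (\<Sum>v\<in>UNIV. f v * edge_vector e $ v))"
    by (subst sum.swap) (simp add: sum_distrib_left)
  finally show ?thesis by (simp add: sum_potential_edge_vector)
qed

lemma net_inflow_nth: "net_inflow c $ v = (\<Sum>u\<in>UNIV. c (u, v)) - (\<Sum>w\<in>UNIV. c (v, w))"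
proof -
  have "net_inflow c $ v = (\<Sum>e\<in>UNIV. c e * edge_vector e $ v)"
    by (simp add: net_inflow_def)
  also have "\<dots> = (\<Sum>a\<in>UNIV. \<Sum>b\<in>UNIV. c (a, b) * edge_vector (a, b) $ v)"
    unfolding sum.cartesian_product by (simp add: UNIV_Times_UNIV case_prod_unfold)
  also have "\<dots> = (\<Sum>a\<in>UNIV. \<Sum>b\<in>UNIV. if b = v then c (a, b) else 0) -
      (\<Sum>a\<in>UNIV. \<Sum>b\<in>UNIV. if a = v then c (a, b) else 0)"
    unfolding sum_subtractf[symmetric] by (intro sum.cong refl) (auto simp: edge_vector_nth)
  also have "(\<Sum>a\<in>UNIV. \<Sum>b\<in>UNIV. if a = v then c (a, b) else 0) =
      (\<Sum>a\<in>UNIV. if a = v then \<Sum>b\<in>UNIV. c (a, b) else 0)"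
    by (intro sum.cong) auto
  finally show ?thesis by (simp add: sum.delta)
qed

lemma inj_on_edge_vector:
  assumes "asym T"
  shows "inj_on edge_vector T"
proof (rule inj_onI)
  fix e e' assume e: "e \<in> T" "e' \<in> T" and eq: "edge_vector e = edge_vector e'"
  have "fst e \<noteq> snd e" "fst e' \<noteq> snd e'" using assms e by (auto dest: asymD simp: prod_eq_iff) (metis asymD prod.collapse)+
  with arg_cong[OF eq, of "\<lambda>y. y $ snd e"] arg_cong[OF eq, of "\<lambda>y. y $ fst e"]
  show "e = e'" by (auto simp: edge_vector_nth prod_eq_iff split: if_splits)
qed

lemma root_polytope_eq: "root_polytope T = convex hull (edge_vector ` T)"
proof -
  have "{axis h 1 - axis t 1 | t h. (t, h) \<in> T} = edge_vector ` T"
    by (force simp: edge_vector_def image_def)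
  then show ?thesis by (simp add: root_polytope_def)
qed

lemma root_polytope_mono: "T \<subseteq> T' \<Longrightarrow> root_polytope T \<subseteq> root_polytope T'"
  unfolding root_polytope_eq by (intro hull_mono image_mono)

lemma net_inflow_on: "flow_on T c \<Longrightarrow> net_inflow c = (\<Sum>e\<in>T. c e *\<^sub>R edge_vector e)"
  unfolding net_inflow_def flow_on_def by (intro sum.mono_neutral_right) auto

lemma net_inflow_in_root_polytope:
  assumes c: "flow_on T c" and sum1: "sum c UNIV = 1"
  shows "net_inflow c \<in> root_polytope T"
proof -
  have "sum c T = 1"
    using c sum1 unfolding flow_on_def by (subst sum.mono_neutral_left[of UNIV]) auto
  then show ?thesis
    unfolding net_inflow_on[OF c] root_polytope_eq using c
    by (intro convex_sum) (auto simp: flow_on_def intro: hull_inc)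
qed

lemma flow_of_root_polytope:
  assumes T: "asym T" and y: "y \<in> root_polytope T"
  obtains c where "flow_on T c" "sum c UNIV = 1" "net_inflow c = y"
proof -
  obtain u where u: "\<forall>w\<in>edge_vector ` T. 0 \<le> u w" "sum u (edge_vector ` T) = 1"
    "(\<Sum>w\<in>edge_vector ` T. u w *\<^sub>R w) = y"
    using y by (auto simp: root_polytope_eq convex_hull_finite)
  define c where "c e = (if e \<in> T then u (edge_vector e) else 0)" for e
  have c: "flow_on T c" using u(1) by (auto simp: flow_on_def c_def)
  have "sum c UNIV = (\<Sum>e\<in>T. u (edge_vector e))"
    by (simp add: c_def sum.If_cases)
  also have "\<dots> = 1" using u(2) by (simp add: sum.reindex[OF inj_on_edge_vector[OF T]])
  finally have "sum c UNIV = 1" .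
  moreover have "net_inflow c = y"
    unfolding net_inflow_on[OF c] u(3)[symmetric]
    by (simp add: sum.reindex[OF inj_on_edge_vector[OF T]] c_def)
  ultimately show thesis using that c by blast
qed

text \<open>
  Pairing a linear relation with the potential of an edge isolates the coefficient of that edge.
\<close>

lemma independent_edge_vectors:
  assumes T: "asym T" and acyc: "\<nexists>p. graph_cycle T p"
  shows "independent (edge_vector ` T)"
proof -
  have "u (edge_vector e) = 0"
    if zero: "(\<Sum>w\<in>edge_vector ` T. u w *\<^sub>R w) = 0" and e: "e \<in> T" for u e
  proof -
    define c where "c e = (if e \<in> T then u (edge_vector e) else 0)" for e
    have "net_inflow c = (\<Sum>e\<in>T. u (edge_vector e) *\<^sub>R edge_vector e)"
      unfolding net_inflow_def by (intro sum.mono_neutral_cong_right) (auto simp: c_def)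
    also have "\<dots> = 0" using zero by (simp add: sum.reindex[OF inj_on_edge_vector[OF T]])
    finally have c: "net_inflow c = 0" .
    obtain f :: "'a \<Rightarrow> real" where f1: "f (snd e) - f (fst e) = 1"
      and f0: "\<And>e'. e' \<in> T \<Longrightarrow> e' \<noteq> e \<Longrightarrow> f (snd e') = f (fst e')"
      using edge_potential_if_acyclic[OF T acyc, of "fst e" "snd e"] e by force
    have "0 = (\<Sum>e'\<in>UNIV. c e' * (f (snd e') - f (fst e')))"
      using sum_potential_net_inflow[of f c] c by simp
    also have "\<dots> = (\<Sum>e'\<in>UNIV. if e' = e then c e else 0)"
      by (intro sum.cong refl) (use f0 f1 in \<open>auto simp: c_def\<close>)
    finally show ?thesis using e by (simp add: c_def)
  qed
  then show ?thesis by (auto simp: dependent_finite)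
qed

lemma span_edge_vectors:
  assumes "(adjacent T)\<^sup>*\<^sup>* u v"
  shows "axis v 1 - axis u 1 \<in> span (edge_vector ` T)"
  using assms
proof (induction rule: rtranclp_induct)
  case base
  show ?case by (simp add: span_zero)
next
  case (step v w)
  have "axis w 1 - axis v 1 \<in> span (edge_vector ` T)"
    using step.hyps(2) unfolding adjacent_def
  proof
    assume "(v, w) \<in> T"
    then have "edge_vector (v, w) \<in> span (edge_vector ` T)" by (intro span_base) simp
    then show ?thesis by (simp add: edge_vector_def)
  next
    assume "(w, v) \<in> T"
    then have "- edge_vector (w, v) \<in> span (edge_vector ` T)" by (intro span_neg span_base) simp
    then show ?thesis by (simp add: edge_vector_def)
  qed
  from span_add[OF step.IH this] show ?case by simp
qed

lemma affine_hull_span_slice: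
  fixes \<phi> :: "'a::real_vector \<Rightarrow> real"
  assumes "finite S" "linear \<phi>" "\<And>w. w \<in> S \<Longrightarrow> \<phi> w = 1" "y \<in> span S" "\<phi> y = 1"
  shows "y \<in> affine hull S"
proof -
  obtain u where y: "y = (\<Sum>w\<in>S. u w *\<^sub>R w)"
    using assms(1,4) by (auto simp: span_finite)
  have "sum u S = \<phi> y"
    unfolding y using assms(2,3) by (simp add: linear_sum linear_cmul)
  then show ?thesis using assms(1,5) y by (auto simp: affine_hull_finite)
qed

text \<open>
  All edge vectors lie on the hyperplane on which the functional given by the layering is 1. A
  linear combination of edge vectors that lies there has coefficient sum 1, so it is an affine
  combination, and along a path in the tree every edge vector of the graph is such a combination.
\<close>

lemma affine_hull_root_polytope_tree:
  assumes E: "layering E l" and T: "T \<subseteq> E" "connected_graph UNIV T"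
  shows "affine hull root_polytope T = affine hull root_polytope E"
proof
  show "affine hull root_polytope T \<subseteq> affine hull root_polytope E"
    by (intro hull_mono root_polytope_mono T)
  let ?\<phi> = "\<lambda>y. \<Sum>v\<in>UNIV. real_of_int (l v) * y $ v"
  have "linear ?\<phi>"
    by (intro linearI) (simp_all add: algebra_simps sum.distrib sum_distrib_left)
  moreover have "?\<phi> (edge_vector e) = 1" if "e \<in> E" for e
  proof -
    have "l (snd e) - l (fst e) = 1" using E that by (auto simp: layering_def)
    then show ?thesis by (simp add: sum_potential_edge_vector flip: of_int_diff)
  qed
  moreover have "edge_vector e \<in> span (edge_vector ` T)" for e
    using span_edge_vectors[of T "fst e" "snd e"] T(2)
    by (auto simp: edge_vector_def connected_graph_def)
  ultimately have "edge_vector ` E \<subseteq> affine hull (edge_vector ` T)"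
    using T(1) by (intro image_subsetI affine_hull_span_slice[where \<phi> = ?\<phi>]) auto
  then show "affine hull root_polytope E \<subseteq> affine hull root_polytope T"
    by (simp add: root_polytope_eq hull_minimal)
qed

lemma root_polytope_tree_simplex:
  assumes E: "asym E" "layering E l" and T: "spanning_tree UNIV E T"
  shows "\<not> affine_dependent (edge_vector ` T)"
    and "aff_dim (root_polytope E) simplex root_polytope T"
proof -
  have "asym T" "T \<subseteq> E" "connected_graph UNIV T"
    using T E(1) by (auto simp: spanning_tree_def intro: asymI dest: asymD)
  then have "independent (edge_vector ` T)"
    using T by (intro independent_edge_vectors) (auto simp: spanning_tree_def)
  then show ind: "\<not> affine_dependent (edge_vector ` T)"
    using affine_dependent_imp_dependent by blast
  have "aff_dim (root_polytope E) = aff_dim (root_polytope T)"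
    using affine_hull_root_polytope_tree[OF E(2) \<open>T \<subseteq> E\<close> \<open>connected_graph UNIV T\<close>]
    by (metis aff_dim_affine_hull)
  also have "\<dots> = int (card (edge_vector ` T)) - 1"
    using ind by (simp add: root_polytope_eq aff_dim_convex_hull aff_dim_affine_independent)
  finally show "aff_dim (root_polytope E) simplex root_polytope T"
    using ind unfolding root_polytope_eq by (intro simplex_convex_hull) simp
qed

text \<open>
  When a point determines its flow irrespective of which of the two graphs carries it, a flow for a
  common point is supported on the common edges. The intersection is thus spanned by a
  subset of the vertices of a simplex, which makes it a face.
\<close>

lemma unique_flows_common_face:
  assumes ind: "\<not> affine_dependent (edge_vector ` T)" and asym: "asym T" "asym T'"
    and uniq: "\<And>c c'. flow_on T c \<Longrightarrow> flow_on T' c' \<Longrightarrow> net_inflow c = net_inflow c' \<Longrightarrow> c = c'"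
  shows "root_polytope T \<inter> root_polytope T' = root_polytope (T \<inter> T')"
    and "(root_polytope T \<inter> root_polytope T') face_of root_polytope T"
proof -
  show eq: "root_polytope T \<inter> root_polytope T' = root_polytope (T \<inter> T')"
  proof
    show "root_polytope (T \<inter> T') \<subseteq> root_polytope T \<inter> root_polytope T'"
      by (simp add: root_polytope_mono)
    show "root_polytope T \<inter> root_polytope T' \<subseteq> root_polytope (T \<inter> T')"
    proof
      fix y assume "y \<in> root_polytope T \<inter> root_polytope T'"
      then obtain c c' where c: "flow_on T c" "sum c UNIV = 1" "net_inflow c = y"
        and c': "flow_on T' c'" "net_inflow c' = y"
        using asym by (metis IntE flow_of_root_polytope)
      with uniq have "c = c'" by simp
      with c c' have "flow_on (T \<inter> T') c" by (auto simp: flow_on_def)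
      with c show "y \<in> root_polytope (T \<inter> T')" using net_inflow_in_root_polytope by blast
    qed
  qed
  have "edge_vector ` (T \<inter> T') \<subseteq> edge_vector ` T" by blast
  with ind show "(root_polytope T \<inter> root_polytope T') face_of root_polytope T"
    unfolding eq unfolding root_polytope_eq by (auto simp: face_of_convex_hull_affine_independent)
qed

lemma root_polytope_full_face:
  assumes ind: "\<not> affine_dependent (edge_vector ` T)" and asym: "asym T"
    and F: "F \<subseteq> T" and eq: "root_polytope F = root_polytope T"
  shows "F = T"
proof -
  have "\<not> affine_dependent (edge_vector ` F)"
    using ind F by (meson affine_dependent_subset image_mono)
  with ind eq have "edge_vector ` F = edge_vector ` T"
    unfolding root_polytope_eq
    by (metis extreme_point_of_convex_hull_affine_independent set_eqI)
  with F asym show ?thesis using inj_on_image_eq_iff[OF inj_on_edge_vector] by blast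
qed

lemma interior_of_affine_hull_subset:
  assumes "affine hull S = A"
  shows "top_of_set A interior_of S \<subseteq> rel_interior S"
  using assms by (auto simp: interior_of_def rel_interior_def)

section \<open>Non-crossing edges and monotone transport\<close>

text \<open>
  Between two horizontal lines, non-crossing is a purely combinatorial condition on the left-to-right
  order: no edge starts to the left and ends to the right of another one.
\<close>

definition monotone_edges :: "('v \<Rightarrow> real) \<Rightarrow> 'v edges \<Rightarrow> bool" where
  "monotone_edges f T \<longleftrightarrow>
     (\<forall>t h t' h'. (t, h) \<in> T \<longrightarrow> (t', h') \<in> T \<longrightarrow> f t < f t' \<longrightarrow> f h \<le> f h')"

lemma monotone_edgesD:
  "monotone_edges f T \<Longrightarrow> (t, h) \<in> T \<Longrightarrow> (t', h') \<in> T \<Longrightarrow> f t < f t' \<Longrightarrow> f h \<le> f h'"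
  unfolding monotone_edges_def by blast

lemma edges_cross_commute: "edges_cross pos e e' \<longleftrightarrow> edges_cross pos e' e"
  by (auto simp: edges_cross_def)

text \<open>
  At height \<open>u\<close> above the lower line, the gap between the two segments is
  \<open>(1 - u) d - u d'\<close>, with \<open>d\<close> and \<open>d'\<close> the gaps on the two lines. It vanishes at
  \<open>u = d / (d + d')\<close>.
\<close>

lemma edges_cross_if_inverted:
  assumes lines: "snd (pos t) = r" "snd (pos t') = r" "snd (pos h) = r + 1" "snd (pos h') = r + 1"
    and inv: "fst (pos t) < fst (pos t')" "fst (pos h') < fst (pos h)"
  shows "edges_cross pos (t, h) (t', h')"
proof -
  define d where "d = fst (pos t') - fst (pos t)"
  define d' where "d' = fst (pos h) - fst (pos h')"
  define u where "u = d / (d + d')"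
  have pos: "0 < d" "0 < d'" using inv by (auto simp: d_def d'_def)
  then have u: "0 < u" "u < 1" "u * (d + d') = d" by (simp_all add: u_def)
  let ?z = "(1 - u) *\<^sub>R pos t + u *\<^sub>R pos h"
  have "?z = (1 - u) *\<^sub>R pos t' + u *\<^sub>R pos h'"
  proof (rule prod_eqI)
    show "fst ?z = fst ((1 - u) *\<^sub>R pos t' + u *\<^sub>R pos h')"
      using u(3) by (simp add: d_def d'_def algebra_simps)
  qed (simp add: lines)
  moreover have "snd (pos t) \<noteq> snd (pos h)" "snd (pos t') \<noteq> snd (pos h')" by (simp_all add: lines)
  then have "pos t \<noteq> pos h" "pos t' \<noteq> pos h'" by metis+
  ultimately have "?z \<in> open_segment (pos t) (pos h)" "?z \<in> open_segment (pos t') (pos h')"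
    using u(1,2) by (auto simp: in_segment)
  moreover have "t \<noteq> t'" using inv by auto
  ultimately show ?thesis by (auto simp: edges_cross_def)
qed

lemma inverted_if_edges_cross:
  assumes lines: "snd (pos t) = r" "snd (pos t') = r" "snd (pos h) = r + 1" "snd (pos h') = r + 1"
    and inj: "fst (pos t) = fst (pos t') \<Longrightarrow> t = t'" "fst (pos h) = fst (pos h') \<Longrightarrow> h = h'"
    and cross: "edges_cross pos (t, h) (t', h')"
  shows "fst (pos t) < fst (pos t') \<and> fst (pos h') < fst (pos h) \<or>
    fst (pos t') < fst (pos t) \<and> fst (pos h) < fst (pos h')"
proof -
  obtain z where "z \<in> open_segment (pos t) (pos h)" "z \<in> open_segment (pos t') (pos h')"
    and ne: "(t, h) \<noteq> (t', h')" using cross by (auto simp: edges_cross_def)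
  then obtain u u' where u: "0 < u" "u < 1"
    and z: "z = (1 - u) *\<^sub>R pos t + u *\<^sub>R pos h" "z = (1 - u') *\<^sub>R pos t' + u' *\<^sub>R pos h'"
    by (auto simp: in_segment)
  have "snd z = r + u" unfolding z(1) by (simp add: lines algebra_simps)
  moreover have "snd z = r + u'" unfolding z(2) by (simp add: lines algebra_simps)
  ultimately have "u' = u" by simp
  with arg_cong[OF z(1), of fst] arg_cong[OF z(2), of fst]
  have eq: "(1 - u) * (fst (pos t) - fst (pos t')) = u * (fst (pos h') - fst (pos h))"
    by (simp add: algebra_simps)
  consider "fst (pos t) = fst (pos t')" | "fst (pos t) < fst (pos t')" | "fst (pos t) > fst (pos t')"
    by linarith
  then show ?thesis
  proof cases
    case 1
    with eq u have "fst (pos h) = fst (pos h')" by simp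
    with 1 inj ne show ?thesis by auto
  next
    case 2
    with u have "(1 - u) * (fst (pos t) - fst (pos t')) < 0" by (simp add: mult_pos_neg)
    with eq have "u * (fst (pos h') - fst (pos h)) < 0" by simp
    with u 2 show ?thesis by (simp add: mult_less_0_iff)
  next
    case 3
    with u have "(1 - u) * (fst (pos t) - fst (pos t')) > 0" by simp
    with eq have "u * (fst (pos h') - fst (pos h)) > 0" by simp
    with u 3 show ?thesis by (simp add: zero_less_mult_iff)
  qed
qed

text \<open>
  A transport plan that respects the orders has no freedom: for initial segments \<open>P\<close> and \<open>Q\<close>,
  either no mass leaves \<open>P\<close> to the right of \<open>Q\<close>, or no mass enters \<open>Q\<close> from the right of
  \<open>P\<close>, since two such amounts would cross. Hence the mass from \<open>P\<close> to \<open>Q\<close> is the whole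
  mass of one of them, namely of the smaller one.
\<close>

lemma monotone_plan_lower_sum:
  fixes c :: "'a \<Rightarrow> 'b \<Rightarrow> real" and p :: "'a \<Rightarrow> real" and q :: "'b \<Rightarrow> real"
  assumes fin: "finite A" "finite B" and nonneg: "\<And>a b. 0 \<le> c a b"
    and mono: "\<And>a b a' b'. a \<in> A \<Longrightarrow> a' \<in> A \<Longrightarrow> b \<in> B \<Longrightarrow> b' \<in> B \<Longrightarrow>
      0 < c a b \<Longrightarrow> 0 < c a' b' \<Longrightarrow> p a < p a' \<Longrightarrow> q b \<le> q b'"
    and P: "P \<subseteq> A" "\<And>a a'. a \<in> P \<Longrightarrow> a' \<in> A - P \<Longrightarrow> p a < p a'"
    and Q: "Q \<subseteq> B" "\<And>b b'. b \<in> Q \<Longrightarrow> b' \<in> B - Q \<Longrightarrow> q b < q b'"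
  shows "(\<Sum>a\<in>P. \<Sum>b\<in>Q. c a b) = min (\<Sum>a\<in>P. \<Sum>b\<in>B. c a b) (\<Sum>b\<in>Q. \<Sum>a\<in>A. c a b)"
proof -
  have row: "(\<Sum>a\<in>P. \<Sum>b\<in>Q. c a b) \<le> (\<Sum>a\<in>P. \<Sum>b\<in>B. c a b)"
    using fin nonneg Q(1) by (intro sum_mono sum_mono2) auto
  have swap: "(\<Sum>a\<in>P. \<Sum>b\<in>Q. c a b) = (\<Sum>b\<in>Q. \<Sum>a\<in>P. c a b)" by (rule sum.swap)
  have col: "(\<Sum>a\<in>P. \<Sum>b\<in>Q. c a b) \<le> (\<Sum>b\<in>Q. \<Sum>a\<in>A. c a b)"
    unfolding swap using fin nonneg P(1) by (intro sum_mono sum_mono2) auto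
  consider "\<And>a b. a \<in> P \<Longrightarrow> b \<in> B - Q \<Longrightarrow> c a b = 0" | "\<And>a b. a \<in> A - P \<Longrightarrow> b \<in> Q \<Longrightarrow> c a b = 0"
  proof (cases "\<exists>a b a' b'. a \<in> P \<and> b \<in> B - Q \<and> c a b \<noteq> 0 \<and> a' \<in> A - P \<and> b' \<in> Q \<and> c a' b' \<noteq> 0")
    case True
    then obtain a b a' b' where 1: "a \<in> P" "b \<in> B - Q" "c a b \<noteq> 0"
      "a' \<in> A - P" "b' \<in> Q" "c a' b' \<noteq> 0" by blast
    then have "0 < c a b" "0 < c a' b'" using nonneg by (simp_all add: less_le)
    moreover have "a \<in> A" "a' \<in> A" "b \<in> B" "b' \<in> B" using 1 P(1) Q(1) by auto
    moreover have "p a < p a'" "q b' < q b" using P(2) Q(2) 1 by simp_all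
    ultimately have "q b \<le> q b'" "q b' < q b" using mono by simp_all
    then show thesis by linarith
  qed (use that in blast)
  then show ?thesis
  proof cases
    case 1
    then have "(\<Sum>a\<in>P. \<Sum>b\<in>Q. c a b) = (\<Sum>a\<in>P. \<Sum>b\<in>B. c a b)"
      using fin Q(1) by (intro sum.cong[OF refl] sum.mono_neutral_left) auto
    with col show ?thesis by simp
  next
    case 2
    then have "(\<Sum>a\<in>P. \<Sum>b\<in>Q. c a b) = (\<Sum>b\<in>Q. \<Sum>a\<in>A. c a b)"
      unfolding swap using fin P(1) by (intro sum.cong[OF refl] sum.mono_neutral_left) auto
    with row show ?thesis by simp
  qed
qed

text \<open>
  The marginals determine the mass of every product of initial segments, and a single entry is
  an alternating sum of four such masses.
\<close>

lemma monotone_plan_unique: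
  fixes c c' :: "'a \<Rightarrow> 'b \<Rightarrow> real" and p :: "'a \<Rightarrow> real" and q :: "'b \<Rightarrow> real"
  assumes fin: "finite A" "finite B" and inj: "inj_on p A" "inj_on q B"
    and c: "\<And>a b. 0 \<le> c a b"
      "\<And>a b a' b'. a \<in> A \<Longrightarrow> a' \<in> A \<Longrightarrow> b \<in> B \<Longrightarrow> b' \<in> B \<Longrightarrow>
        0 < c a b \<Longrightarrow> 0 < c a' b' \<Longrightarrow> p a < p a' \<Longrightarrow> q b \<le> q b'"
    and c': "\<And>a b. 0 \<le> c' a b"
      "\<And>a b a' b'. a \<in> A \<Longrightarrow> a' \<in> A \<Longrightarrow> b \<in> B \<Longrightarrow> b' \<in> B \<Longrightarrow>
        0 < c' a b \<Longrightarrow> 0 < c' a' b' \<Longrightarrow> p a < p a' \<Longrightarrow> q b \<le> q b'"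
    and marg: "\<And>a. a \<in> A \<Longrightarrow> (\<Sum>b\<in>B. c a b) = (\<Sum>b\<in>B. c' a b)"
      "\<And>b. b \<in> B \<Longrightarrow> (\<Sum>a\<in>A. c a b) = (\<Sum>a\<in>A. c' a b)"
    and ab: "a \<in> A" "b \<in> B"
  shows "c a b = c' a b"
proof -
  have lower: "(\<Sum>a\<in>P. \<Sum>b\<in>Q. c a b) = (\<Sum>a\<in>P. \<Sum>b\<in>Q. c' a b)"
    if P: "P \<subseteq> A" "\<And>a a'. a \<in> P \<Longrightarrow> a' \<in> A - P \<Longrightarrow> p a < p a'"
      and Q: "Q \<subseteq> B" "\<And>b b'. b \<in> Q \<Longrightarrow> b' \<in> B - Q \<Longrightarrow> q b < q b'" for P Q
  proof -
    have "(\<Sum>a\<in>P. \<Sum>b\<in>B. c a b) = (\<Sum>a\<in>P. \<Sum>b\<in>B. c' a b)"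
      using P(1) marg(1) by - (rule sum.cong[OF refl], auto)
    moreover have "(\<Sum>b\<in>Q. \<Sum>a\<in>A. c a b) = (\<Sum>b\<in>Q. \<Sum>a\<in>A. c' a b)"
      using Q(1) marg(2) by - (rule sum.cong[OF refl], auto)
    moreover have "(\<Sum>a\<in>P. \<Sum>b\<in>Q. c a b) = min (\<Sum>a\<in>P. \<Sum>b\<in>B. c a b) (\<Sum>b\<in>Q. \<Sum>a\<in>A. c a b)"
      by (rule monotone_plan_lower_sum[OF fin c P Q])
    moreover have "(\<Sum>a\<in>P. \<Sum>b\<in>Q. c' a b) = min (\<Sum>a\<in>P. \<Sum>b\<in>B. c' a b) (\<Sum>b\<in>Q. \<Sum>a\<in>A. c' a b)"
      by (rule monotone_plan_lower_sum[OF fin c' P Q])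
    ultimately show ?thesis by simp
  qed
  define P where "P = {a'\<in>A. p a' < p a}"
  define Q where "Q = {b'\<in>B. q b' < q b}"
  have P: "P \<subseteq> A" "insert a P \<subseteq> A" "a \<notin> P" "finite P"
    and Q: "Q \<subseteq> B" "insert b Q \<subseteq> B" "b \<notin> Q" "finite Q"
    using ab fin by (auto simp: P_def Q_def)
  have P_lower: "p a1 < p a2" if "a1 \<in> P" "a2 \<in> A - P" for a1 a2
    using that by (auto simp: P_def)
  have Q_lower: "q b1 < q b2" if "b1 \<in> Q" "b2 \<in> B - Q" for b1 b2
    using that by (auto simp: Q_def)
  \<comment> \<open>Injectivity makes \<open>a\<close> the only element to be added to \<open>P\<close> to reach the next initial segment.\<close>
  have aP_lower: "p a1 < p a2" if "a1 \<in> insert a P" "a2 \<in> A - insert a P" for a1 a2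
    using that ab(1) inj_onD[OF inj(1), of a a2] by (force simp: P_def not_less)
  have bQ_lower: "q b1 < q b2" if "b1 \<in> insert b Q" "b2 \<in> B - insert b Q" for b1 b2
    using that ab(2) inj_onD[OF inj(2), of b b2] by (force simp: Q_def not_less)
  note lower[OF P(1) P_lower Q(1) Q_lower] lower[OF P(2) aP_lower Q(1) Q_lower]
    lower[OF P(1) P_lower Q(2) bQ_lower] lower[OF P(2) aP_lower Q(2) bQ_lower]
  then show ?thesis using P(3,4) Q(3,4) by (simp add: sum.distrib)
qed

text \<open>
  The north-west corner rule: ship as much as possible from the leftmost source to the leftmost
  sink. One of them is then exhausted and can be removed, so it is a leaf of the tree under
  construction. Zero amounts and simultaneous exhaustion are admitted, and the last vertex of a
  class is never removed. This is why the result is a full spanning tree rather than just a forest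
  supporting the plan.
\<close>

lemma northwest_corner_tree:
  fixes a b :: "'v \<Rightarrow> real"
  assumes "finite A" "finite B" "A \<noteq> {}" "B \<noteq> {}" "A \<inter> B = {}" "inj_on f A" "inj_on f B"
    and "\<And>u. u \<in> A \<Longrightarrow> 0 \<le> a u" "\<And>v. v \<in> B \<Longrightarrow> 0 \<le> b v" "sum a A = sum b B"
  shows "\<exists>T c. spanning_tree (A \<union> B) (A \<times> B) T \<and> monotone_edges f T \<and>
    (\<forall>e. 0 \<le> c e) \<and> (\<forall>e. e \<notin> T \<longrightarrow> c e = 0) \<and>
    (\<forall>u\<in>A. (\<Sum>v\<in>B. c (u, v)) = a u) \<and> (\<forall>v\<in>B. (\<Sum>u\<in>A. c (u, v)) = b v)"
  using assms
proof (induction "card A + card B" arbitrary: A B a b rule: less_induct)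
  case less
  note fin = less.prems(1,2) and ne = less.prems(3,4) and disj = less.prems(5)
    and inj = less.prems(6,7) and a = less.prems(8) and b = less.prems(9) and total = less.prems(10)
  have asym: "asym (A \<times> B)" using disj by (auto intro: asymI)
  obtain u where u: "u \<in> A" "\<And>t. t \<in> A \<Longrightarrow> f u \<le> f t"
    using fin(1) ne(1) by (metis arg_min_if_finite(1) arg_min_least)
  obtain v where v: "v \<in> B" "\<And>t. t \<in> B \<Longrightarrow> f v \<le> f t"
    using fin(2) ne(2) by (metis arg_min_if_finite(1) arg_min_least)
  have uv: "u \<noteq> v" using u v disj by auto
  have mono_insert: "monotone_edges f (insert (u, v) T)"
    if "monotone_edges f T" "T \<subseteq> A \<times> B" for T
    using that u(2) v(2) unfolding monotone_edges_def by (fastforce simp: not_le[symmetric])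
  \<comment> \<open>A class that consists of its leftmost vertex alone carries the whole amount.\<close>
  consider (row) "A \<noteq> {u}" "a u \<le> b v" | (col) "B \<noteq> {v}" "b v \<le> a u" | (single) "A = {u}" "B = {v}"
  proof -
    have "b v \<le> a u" if "A = {u}"
      using total that member_le_sum[of v B b] v(1) b fin(2) by simp
    moreover have "a u \<le> b v" if "B = {v}"
      using total that member_le_sum[of u A a] u(1) a fin(1) by simp
    ultimately show thesis using that by linarith
  qed
  then show ?case
  proof cases
    case row
    define A' where "A' = A - {u}"
    define b' where "b' = b(v := b v - a u)"
    have A: "A = insert u A'" "u \<notin> A'" using u(1) by (auto simp: A'_def)
    have fin': "finite A'" using fin(1) by (simp add: A'_def)
    have "sum b' B = sum b B - a u"
      using fin(2) v(1) by (simp add: b'_def sum.remove[of B v] cong: sum.cong_simp)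
    then have total': "sum a A' = sum b' B" using total fin' A by simp
    have IH: "\<exists>T c. spanning_tree (A' \<union> B) (A' \<times> B) T \<and> monotone_edges f T \<and>
      (\<forall>e. 0 \<le> c e) \<and> (\<forall>e. e \<notin> T \<longrightarrow> c e = 0) \<and>
      (\<forall>u\<in>A'. (\<Sum>v\<in>B. c (u, v)) = a u) \<and> (\<forall>v\<in>B. (\<Sum>u\<in>A'. c (u, v)) = b' v)"
    proof (rule less.hyps)
      show "card A' + card B < card A + card B" using A fin' by simp
      show "A' \<noteq> {}" using row(1) u(1) by (auto simp: A'_def)
    qed (use fin fin' ne disj inj a b row total' in \<open>auto simp: A'_def b'_def inj_on_diff\<close>)
    then obtain T c where T: "spanning_tree (A' \<union> B) (A' \<times> B) T" "monotone_edges f T"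
      and c: "\<And>e. 0 \<le> c e" "\<And>e. e \<notin> T \<Longrightarrow> c e = 0"
        "\<And>t. t \<in> A' \<Longrightarrow> (\<Sum>w\<in>B. c (t, w)) = a t" "\<And>w. w \<in> B \<Longrightarrow> (\<Sum>t\<in>A'. c (t, w)) = b' w"
      by blast
    have T_sub: "T \<subseteq> A' \<times> B" using T(1) by (simp add: spanning_tree_def)
    let ?c = "c((u, v) := a u)"
    have "c (u, w) = 0" for w using T_sub A(2) by (intro c(2)) blast
    then have cu: "?c (u, w) = (if w = v then a u else 0)" for w by simp
    have ct: "?c (t, w) = c (t, w)" if "t \<in> A'" for t w using that A(2) by auto
    have "spanning_tree ((A' \<union> B) \<union> {u, v}) (A \<times> B) (T \<union> {(u, v)})"
    proof (rule spanning_tree_glue[OF asym, where r = v])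
      show "spanning_tree (A' \<union> B) (A \<times> B) T"
        using T(1) by (rule spanning_tree_mono) (auto simp: A)
      show "spanning_tree {u, v} (A \<times> B) {(u, v)}"
        using uv u(1) v(1) by (intro spanning_tree_single_edge) auto
      show "(A' \<union> B) \<inter> {u, v} = {v}" using A(2) u(1) v(1) disj by auto
    qed
    moreover have "(A' \<union> B) \<union> {u, v} = A \<union> B" using A v(1) by auto
    ultimately have "spanning_tree (A \<union> B) (A \<times> B) (insert (u, v) T)" by simp
    moreover have "monotone_edges f (insert (u, v) T)" using T(2) T_sub A by (intro mono_insert) auto
    moreover have "(\<Sum>w\<in>B. ?c (t, w)) = a t" if "t \<in> A" for t
    proof (cases "t = u")
      case True
      then show ?thesis using cu fin(2) v(1) by simp
    next
      case False
      then have "t \<in> A'" using that by (simp add: A)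
      then show ?thesis using c(3) ct by simp
    qed
    moreover have "(\<Sum>t\<in>A. ?c (t, w)) = b w" if "w \<in> B" for w
    proof -
      have "(\<Sum>t\<in>A. ?c (t, w)) = ?c (u, w) + (\<Sum>t\<in>A'. ?c (t, w))" using A fin' by simp
      also have "(\<Sum>t\<in>A'. ?c (t, w)) = b' w" using c(4)[OF that] ct by (simp cong: sum.cong)
      finally show ?thesis unfolding cu by (simp add: b'_def)
    qed
    moreover have "0 \<le> ?c e" for e using c(1) a u(1) by simp
    moreover have "?c e = 0" if "e \<notin> insert (u, v) T" for e using that c(2) by simp
    ultimately show ?thesis by blast
  next
    case col
    define B' where "B' = B - {v}"
    define a' where "a' = a(u := a u - b v)"
    have B: "B = insert v B'" "v \<notin> B'" using v(1) by (auto simp: B'_def)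
    have fin': "finite B'" using fin(2) by (simp add: B'_def)
    have "sum a' A = sum a A - b v"
      using fin(1) u(1) by (simp add: a'_def sum.remove[of A u] cong: sum.cong_simp)
    then have total': "sum a' A = sum b B'" using total fin' B by simp
    have IH: "\<exists>T c. spanning_tree (A \<union> B') (A \<times> B') T \<and> monotone_edges f T \<and>
      (\<forall>e. 0 \<le> c e) \<and> (\<forall>e. e \<notin> T \<longrightarrow> c e = 0) \<and>
      (\<forall>u\<in>A. (\<Sum>v\<in>B'. c (u, v)) = a' u) \<and> (\<forall>v\<in>B'. (\<Sum>u\<in>A. c (u, v)) = b v)"
    proof (rule less.hyps)
      show "card A + card B' < card A + card B" using B fin' by simp
      show "B' \<noteq> {}" using col(1) v(1) by (auto simp: B'_def)
    qed (use fin fin' ne disj inj a b col total' in \<open>auto simp: B'_def a'_def inj_on_diff\<close>)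
    then obtain T c where T: "spanning_tree (A \<union> B') (A \<times> B') T" "monotone_edges f T"
      and c: "\<And>e. 0 \<le> c e" "\<And>e. e \<notin> T \<Longrightarrow> c e = 0"
        "\<And>t. t \<in> A \<Longrightarrow> (\<Sum>w\<in>B'. c (t, w)) = a' t" "\<And>w. w \<in> B' \<Longrightarrow> (\<Sum>t\<in>A. c (t, w)) = b w"
      by blast
    have T_sub: "T \<subseteq> A \<times> B'" using T(1) by (simp add: spanning_tree_def)
    let ?c = "c((u, v) := b v)"
    have "c (t, v) = 0" for t using T_sub B(2) by (intro c(2)) blast
    then have cv: "?c (t, v) = (if t = u then b v else 0)" for t by simp
    have cw: "?c (t, w) = c (t, w)" if "w \<in> B'" for t w using that B(2) by auto
    have "spanning_tree ((A \<union> B') \<union> {u, v}) (A \<times> B) (T \<union> {(u, v)})"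
    proof (rule spanning_tree_glue[OF asym, where r = u])
      show "spanning_tree (A \<union> B') (A \<times> B) T"
        using T(1) by (rule spanning_tree_mono) (auto simp: B)
      show "spanning_tree {u, v} (A \<times> B) {(u, v)}"
        using uv u(1) v(1) by (intro spanning_tree_single_edge) auto
      show "(A \<union> B') \<inter> {u, v} = {u}" using B(2) u(1) v(1) disj by auto
    qed
    moreover have "(A \<union> B') \<union> {u, v} = A \<union> B" using B u(1) by auto
    ultimately have "spanning_tree (A \<union> B) (A \<times> B) (insert (u, v) T)" by simp
    moreover have "monotone_edges f (insert (u, v) T)" using T(2) T_sub B by (intro mono_insert) auto
    moreover have "(\<Sum>t\<in>A. ?c (t, w)) = b w" if "w \<in> B" for w
    proof (cases "w = v")
      case True
      then show ?thesis using cv fin(1) u(1) by simp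
    next
      case False
      then have "w \<in> B'" using that by (simp add: B)
      then show ?thesis using c(4) cw by simp
    qed
    moreover have "(\<Sum>w\<in>B. ?c (t, w)) = a t" if "t \<in> A" for t
    proof -
      have "(\<Sum>w\<in>B. ?c (t, w)) = ?c (t, v) + (\<Sum>w\<in>B'. ?c (t, w))" using B fin' by simp
      also have "(\<Sum>w\<in>B'. ?c (t, w)) = a' t" using c(3)[OF that] cw by (simp cong: sum.cong)
      finally show ?thesis unfolding cv by (simp add: a'_def)
    qed
    moreover have "0 \<le> ?c e" for e using c(1) b v(1) by simp
    moreover have "?c e = 0" if "e \<notin> insert (u, v) T" for e using that c(2) by simp
    ultimately show ?thesis by blast
  next
    case single
    have "spanning_tree {u, v} (A \<times> B) {(u, v)}"
      using uv u(1) v(1) by (intro spanning_tree_single_edge) auto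
    moreover have "a u = b v" using total single by simp
    moreover have "0 \<le> a u" using a u(1) .
    ultimately show ?thesis unfolding single
      by (intro exI[of _ "{(u, v)}"] exI[of _ "(\<lambda>_. 0)((u, v) := a u)"])
        (auto simp: monotone_edges_def insert_commute)
  qed
qed

section \<open>Inflow and outflow at a vertex\<close>

definition inflow :: "('v::finite \<times> 'v \<Rightarrow> real) \<Rightarrow> 'v \<Rightarrow> real" where
  "inflow c v = (\<Sum>u\<in>UNIV. c (u, v))"

definition outflow :: "('v::finite \<times> 'v \<Rightarrow> real) \<Rightarrow> 'v \<Rightarrow> real" where
  "outflow c v = (\<Sum>w\<in>UNIV. c (v, w))"

lemma net_inflow_eq: "net_inflow c $ v = inflow c v - outflow c v"
  by (simp add: net_inflow_nth inflow_def outflow_def)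

lemma flow_on_mono: "flow_on T c \<Longrightarrow> T \<subseteq> T' \<Longrightarrow> flow_on T' c"
  unfolding flow_on_def by blast

lemma flow_on_eq_0: "flow_on T c \<Longrightarrow> e \<notin> T \<Longrightarrow> c e = 0"
  unfolding flow_on_def by blast

lemma inflow_nonneg: "flow_on T c \<Longrightarrow> 0 \<le> inflow c v"
  by (auto simp: flow_on_def inflow_def intro: sum_nonneg)

lemma outflow_nonneg: "flow_on T c \<Longrightarrow> 0 \<le> outflow c v"
  by (auto simp: flow_on_def outflow_def intro: sum_nonneg)

lemma inflow_eq_0: "flow_on T c \<Longrightarrow> (\<And>u. (u, v) \<notin> T) \<Longrightarrow> inflow c v = 0"
  by (simp add: flow_on_def inflow_def)

lemma outflow_eq_0: "flow_on T c \<Longrightarrow> (\<And>w. (v, w) \<notin> T) \<Longrightarrow> outflow c v = 0"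
  by (simp add: flow_on_def outflow_def)

section \<open>Comb-trees in a layer-complete graph\<close>

locale layer_complete_presentation =
  fixes E :: "('v::finite) edges" and l :: "'v \<Rightarrow> int" and k :: nat
    and s :: "nat \<Rightarrow> nat" and x :: "nat \<Rightarrow> nat \<Rightarrow> 'v" and pos :: "'v \<Rightarrow> real \<times> real"
  assumes layer_complete: "layer_complete E l" and k_pos: "1 \<le> k"
    and layers: "{i. layer l i \<noteq> {}} = {0..int k}"
    and planar: "planar_presentation l k s x pos"
begin

lemma asym_E: "asym E" and layering_E: "layering E l"
  using layer_complete by (auto simp: layer_complete_def)

lemma level_bounds: "0 \<le> l v" "l v \<le> int k"
proof -
  have "layer l (l v) \<noteq> {}" by (auto simp: layer_def)
  then have "l v \<in> {0..int k}" using layers by blast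
  then show "0 \<le> l v" "l v \<le> int k" by auto
qed

lemma edge_iff: "(t, h) \<in> E \<longleftrightarrow> l h = l t + 1"
proof
  show "(t, h) \<in> E \<Longrightarrow> l h = l t + 1" using layering_E by (auto simp: layering_def)
next
  assume "l h = l t + 1"
  then have "t \<in> layer l (l t)" "h \<in> layer l (l t + 1)" by (auto simp: layer_def)
  then show "(t, h) \<in> E" using layer_complete unfolding layer_complete_def by blast
qed

lemma vertex_indexed:
  obtains j where "v = x (nat (l v)) j" "j \<le> s (nat (l v))"
proof -
  have "nat (l v) \<le> k" "v \<in> layer l (int (nat (l v)))"
    using level_bounds[of v] by (auto simp: layer_def)
  with planar have "v \<in> x (nat (l v)) ` {0..s (nat (l v))}"
    unfolding planar_presentation_def by (metis bij_betw_imp_surj_on)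
  then show thesis using that by auto
qed

lemma snd_pos: "snd (pos v) = real_of_int (l v)"
proof -
  obtain j where j: "v = x (nat (l v)) j" "j \<le> s (nat (l v))" by (rule vertex_indexed)
  have "nat (l v) \<le> k" using level_bounds[of v] by simp
  with planar j(2) have "snd (pos (x (nat (l v)) j)) = real (nat (l v))"
    unfolding planar_presentation_def by blast
  with j(1) level_bounds[of v] show ?thesis by simp
qed

abbreviation hpos :: "'v \<Rightarrow> real" where "hpos v \<equiv> fst (pos v)"

lemma hpos_inj:
  assumes "l u = l v" "hpos u = hpos v"
  shows "u = v"
proof -
  obtain j where j: "u = x (nat (l u)) j" "j \<le> s (nat (l u))" by (rule vertex_indexed)
  obtain j' where j': "v = x (nat (l v)) j'" "j' \<le> s (nat (l v))" by (rule vertex_indexed)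
  let ?i = "nat (l u)"
  have "?i \<le> k" using level_bounds[of u] by simp
  with planar have lt: "hpos (x ?i a) < hpos (x ?i b)" if "a < b" "b \<le> s ?i" for a b
    using that unfolding planar_presentation_def by blast
  have "hpos (x ?i j) = hpos (x ?i j')" using j(1) j'(1) assms by simp
  then have "j = j'"
    using lt[of j j'] lt[of j' j] j(2) j'(2) assms(1) by (cases j j' rule: linorder_cases) auto
  then show ?thesis using j(1) j'(1) assms(1) by simp
qed

text \<open>
  The vertices \<open>x i 0\<close> are the only ones at which consecutive trees of a comb-tree meet.
\<close>

definition spine :: "'v set" where
  "spine = (\<lambda>i. x i 0) ` {..k}"

lemma level_first: "i \<le> k \<Longrightarrow> l (x i 0) = int i"
  using planar unfolding planar_presentation_def bij_betw_def layer_def by fastforce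

lemma spine_iff: "v \<in> spine \<longleftrightarrow> v = x (nat (l v)) 0"
proof
  show "v \<in> spine \<Longrightarrow> v = x (nat (l v)) 0" by (auto simp: spine_def level_first)
  show "v = x (nat (l v)) 0 \<Longrightarrow> v \<in> spine"
    using level_bounds[of v] unfolding spine_def by (metis atMost_iff imageI nat_le_iff)
qed

lemma spine_unique: "u \<in> spine \<Longrightarrow> v \<in> spine \<Longrightarrow> l u = l v \<Longrightarrow> u = v"
  by (metis spine_iff)

lemma layer_eq_insert_first:
  assumes "v \<in> spine"
  shows "{w. l w = l v} = insert v {w. l w = l v \<and> w \<notin> spine}"
  using assms spine_unique by blast

lemma layer_minus_first:
  "layer l (int i) - {x i 0} = {v. l v = int i \<and> v \<notin> spine}"
  by (auto simp: layer_def spine_iff)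

lemma edges_cross_iff:
  assumes "(t, h) \<in> E" "(t', h') \<in> E" "l h = l h'"
  shows "edges_cross pos (t, h) (t', h') \<longleftrightarrow>
    hpos t < hpos t' \<and> hpos h' < hpos h \<or> hpos t' < hpos t \<and> hpos h < hpos h'"
proof -
  define r where "r = snd (pos t)"
  have lev: "l h = l t + 1" "l t' = l t" "l h' = l t + 1" using assms by (auto simp: edge_iff)
  have lines: "snd (pos t) = r" "snd (pos t') = r" "snd (pos h) = r + 1" "snd (pos h') = r + 1"
    using lev by (simp_all add: r_def snd_pos)
  show ?thesis
  proof
    assume "edges_cross pos (t, h) (t', h')"
    from inverted_if_edges_cross[OF lines _ _ this]
    show "hpos t < hpos t' \<and> hpos h' < hpos h \<or> hpos t' < hpos t \<and> hpos h < hpos h'"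
      using hpos_inj lev by simp
  next
    assume "hpos t < hpos t' \<and> hpos h' < hpos h \<or> hpos t' < hpos t \<and> hpos h < hpos h'"
    then show "edges_cross pos (t, h) (t', h')"
      using edges_cross_if_inverted[of pos t r t' h h', OF lines]
        edges_cross_if_inverted[of pos t' r t h' h, OF lines(2,1,4,3)] edges_cross_commute by blast
  qed
qed

lemma comb_tree_spanning:
  "noncrossing_comb_tree E l k x pos T \<Longrightarrow> spanning_tree UNIV E T"
  by (simp add: noncrossing_comb_tree_def)

text \<open>
  What makes flows on comb-trees unique, extracted from the definition with every vertex
  located by its own level instead of an index of a layer.
\<close>

lemma comb_tree_decomposition:
  assumes "noncrossing_comb_tree E l k x pos T"
  obtains D U S where
    "\<And>i. i \<le> k \<Longrightarrow> D i \<inter> U i = {}"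
    "\<And>i v. i \<le> k \<Longrightarrow> v \<in> D i \<union> U i \<longleftrightarrow> l v = int i \<and> v \<notin> spine"
    "\<And>t h. (t, h) \<in> T \<Longrightarrow> (t, h) \<in> S (nat (l h)) \<and> h \<in> D (nat (l h)) \<union> spine \<and>
       t \<in> U (nat (l t)) \<union> spine"
    "\<And>i e e'. e \<in> S i \<Longrightarrow> e' \<in> S i \<Longrightarrow> i \<in> {1..k} \<Longrightarrow> \<not> edges_cross pos e e'"
proof -
  obtain D U S where DU: "\<forall>i\<le>k. D i \<union> U i = layer l (int i) - {x i 0} \<and> D i \<inter> U i = {}"
    and S: "\<forall>i\<in>{1..k}. noncrossing_tree pos
      ({x (i - 1) 0} \<union> U (i - 1)) ({x i 0} \<union> D i) (S i)"
    and T: "T = (\<Union>i\<in>{1..k}. S i)"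
    using assms unfolding noncrossing_comb_tree_def by blast
  have DU_iff: "v \<in> D i \<union> U i \<longleftrightarrow> l v = int i \<and> v \<notin> spine" if "i \<le> k" for i v
    using DU that layer_minus_first[of i] by blast
  show thesis
  proof
    fix i assume "i \<le> k"
    then show "D i \<inter> U i = {}" using DU by blast
    fix v show "v \<in> D i \<union> U i \<longleftrightarrow> l v = int i \<and> v \<notin> spine" by (rule DU_iff[OF \<open>i \<le> k\<close>])
  next
    fix i e e' assume "e \<in> S i" "e' \<in> S i" "i \<in> {1..k}"
    then show "\<not> edges_cross pos e e'" using S unfolding noncrossing_tree_def by blast
  next
    fix t h assume "(t, h) \<in> T"
    then obtain i where i: "i \<in> {1..k}" "(t, h) \<in> S i" using T by blast
    with S have th: "t \<in> {x (i - 1) 0} \<union> U (i - 1)" "h \<in> {x i 0} \<union> D i"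
      unfolding noncrossing_tree_def spanning_tree_def by blast+
    have "l h = int i" using th(2) DU_iff[of i h] level_first[of i] i(1) by auto
    moreover have "l t = int (i - 1)"
      using th(1) DU_iff[of "i - 1" t] level_first[of "i - 1"] i(1) by auto
    moreover have "x i 0 \<in> spine" "x (i - 1) 0 \<in> spine" using i(1) by (auto simp: spine_def)
    ultimately show "(t, h) \<in> S (nat (l h)) \<and> h \<in> D (nat (l h)) \<union> spine \<and>
       t \<in> U (nat (l t)) \<union> spine" using th i(2) by auto
  qed
qed

lemma comb_tree_one_sided:
  assumes T: "noncrossing_comb_tree E l k x pos T" and e: "(u, v) \<in> T" "(v, w) \<in> T"
  shows "v \<in> spine"
proof -
  obtain D U :: "nat \<Rightarrow> 'v set" and S :: "nat \<Rightarrow> 'v edges" where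
    disj: "\<And>i. i \<le> k \<Longrightarrow> D i \<inter> U i = {}"
    and edge: "\<And>t h. (t, h) \<in> T \<Longrightarrow> (t, h) \<in> S (nat (l h)) \<and>
      h \<in> D (nat (l h)) \<union> spine \<and> t \<in> U (nat (l t)) \<union> spine"
    using comb_tree_decomposition[OF T] by metis
  have "nat (l v) \<le> k" using level_bounds[of v] by simp
  with disj edge[OF e(1)] edge[OF e(2)] show ?thesis by blast
qed

lemma comb_tree_monotone:
  assumes T: "noncrossing_comb_tree E l k x pos T" and e: "(t, h) \<in> T" "(t', h') \<in> T" "l h = l h'"
    and lt: "hpos t < hpos t'"
  shows "hpos h \<le> hpos h'"
proof -
  have E: "(t, h) \<in> E" "(t', h') \<in> E"
    using comb_tree_spanning[OF T] e by (auto simp: spanning_tree_def)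
  obtain D U :: "nat \<Rightarrow> 'v set" and S :: "nat \<Rightarrow> 'v edges" where
    edge: "\<And>t h. (t, h) \<in> T \<Longrightarrow> (t, h) \<in> S (nat (l h)) \<and>
      h \<in> D (nat (l h)) \<union> spine \<and> t \<in> U (nat (l t)) \<union> spine"
    and nc: "\<And>i e e'. e \<in> S i \<Longrightarrow> e' \<in> S i \<Longrightarrow> i \<in> {1..k} \<Longrightarrow> \<not> edges_cross pos e e'"
    using comb_tree_decomposition[OF T] by metis
  have S: "(t, h) \<in> S (nat (l h))" "(t', h') \<in> S (nat (l h'))" using edge e by blast+
  have "1 \<le> l h" using E(1) level_bounds[of t] by (simp add: edge_iff)
  then have "nat (l h) \<in> {1..k}" using level_bounds[of h] by auto
  from nc[OF S(1) _ this] S(2) e(3)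
  have "\<not> edges_cross pos (t, h) (t', h')" by simp
  with edges_cross_iff[OF E e(3)] lt show ?thesis by auto
qed

definition upper_sum :: "real ^ 'v \<Rightarrow> int \<Rightarrow> real" where
  "upper_sum y i = (\<Sum>w | i \<le> l w. y $ w)"

lemma upper_sum_split: "upper_sum y i = (\<Sum>v | l v = i. y $ v) + upper_sum y (i + 1)"
proof -
  have "{w. i \<le> l w} = {v. l v = i} \<union> {w. i + 1 \<le> l w}" by auto
  then show ?thesis unfolding upper_sum_def by (simp only:) (subst sum.union_disjoint, auto)
qed

text \<open>
  The indicator function of the levels from \<open>i\<close> upwards increases exactly along the edges that
  enter layer \<open>i\<close>. Hence the amount that crosses from one layer to the next depends on the
  net inflows only.
\<close>

lemma layer_inflow:
  assumes c: "flow_on E c"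
  shows "(\<Sum>v | l v = i. inflow c v) = upper_sum (net_inflow c) i"
proof -
  define f where "f v = (if i \<le> l v then 1 else 0 :: real)" for v
  have "upper_sum (net_inflow c) i = (\<Sum>v\<in>UNIV. f v * net_inflow c $ v)"
    unfolding upper_sum_def f_def
    by (rule sum.mono_neutral_cong_left) auto
  also have "\<dots> = (\<Sum>e\<in>UNIV. c e * (f (snd e) - f (fst e)))" by (rule sum_potential_net_inflow)
  also have "\<dots> = (\<Sum>e\<in>UNIV. if l (snd e) = i then c e else 0)"
  proof (rule sum.cong[OF refl])
    fix e :: "'v \<times> 'v"
    show "c e * (f (snd e) - f (fst e)) = (if l (snd e) = i then c e else 0)"
    proof (cases "e \<in> E")
      case True
      then have "l (snd e) = l (fst e) + 1" using edge_iff[of "fst e" "snd e"] by simp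
      then show ?thesis by (auto simp: f_def)
    next
      case False
      then have "c e = 0" using c by (rule flow_on_eq_0[rotated])
      then show ?thesis by simp
    qed
  qed
  also have "\<dots> = (\<Sum>u\<in>UNIV. \<Sum>v\<in>UNIV. if l v = i then c (u, v) else 0)"
    unfolding sum.cartesian_product UNIV_Times_UNIV by (intro sum.cong) auto
  also have "\<dots> = (\<Sum>v\<in>UNIV. if l v = i then inflow c v else 0)"
    by (subst sum.swap) (auto simp: inflow_def intro!: sum.cong)
  also have "\<dots> = (\<Sum>v | l v = i. inflow c v)"
    by (rule sum.mono_neutral_cong_right) auto
  finally show ?thesis ..
qed

lemma flow_total:
  assumes c: "flow_on E c"
  shows "sum c UNIV = (\<Sum>v\<in>UNIV. real_of_int (l v) * net_inflow c $ v)"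
  unfolding sum_potential_net_inflow
proof (rule sum.cong[OF refl])
  fix e :: "'v \<times> 'v"
  show "c e = c e * (real_of_int (l (snd e)) - real_of_int (l (fst e)))"
  proof (cases "e \<in> E")
    case True
    then have "l (snd e) = l (fst e) + 1" using edge_iff[of "fst e" "snd e"] by simp
    then show ?thesis by simp
  next
    case False
    then show ?thesis using flow_on_eq_0[OF c] by simp
  qed
qed

text \<open>
  The inflow that a comb-tree is forced to have at each vertex when the net inflows are \<open>y\<close>: away
  from the spine, a vertex has edges in one direction only, so the sign of its net inflow tells which;
  a spine vertex receives what is left of the total amount that enters its layer.
\<close>

definition required_inflow :: "real ^ 'v \<Rightarrow> 'v \<Rightarrow> real" where
  "required_inflow y v = (if v \<in> spine
     then upper_sum y (l v) - (\<Sum>w | l w = l v \<and> w \<notin> spine. max 0 (y $ w))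
     else max 0 (y $ v))"

definition required_outflow :: "real ^ 'v \<Rightarrow> 'v \<Rightarrow> real" where
  "required_outflow y v = required_inflow y v - y $ v"

lemma upper_sum_inflow:
  assumes c: "flow_on E c" and v: "v \<in> spine"
  shows "upper_sum (net_inflow c) (l v) =
    inflow c v + (\<Sum>w | l w = l v \<and> w \<notin> spine. inflow c w)"
  unfolding layer_inflow[OF c, symmetric] layer_eq_insert_first[OF v] using v by simp

lemma comb_tree_inflow:
  assumes T: "noncrossing_comb_tree E l k x pos T" and c: "flow_on T c"
  shows "inflow c v = required_inflow (net_inflow c) v"
proof -
  have nonspine: "inflow c w = max 0 (net_inflow c $ w)" if "w \<notin> spine" for w
  proof -
    have "inflow c w = 0 \<or> outflow c w = 0"
      using inflow_eq_0[OF c] outflow_eq_0[OF c] comb_tree_one_sided[OF T] that by blast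
    then show ?thesis
      unfolding net_inflow_eq using inflow_nonneg[OF c, of w] outflow_nonneg[OF c, of w] by auto
  qed
  show ?thesis
  proof (cases "v \<in> spine")
    case True
    have "flow_on E c"
      using c comb_tree_spanning[OF T] by (auto simp: spanning_tree_def intro: flow_on_mono)
    from upper_sum_inflow[OF this True] True show ?thesis
      by (simp add: required_inflow_def nonspine)
  next
    case False
    then show ?thesis by (simp add: required_inflow_def nonspine)
  qed
qed

lemma comb_tree_outflow:
  assumes "noncrossing_comb_tree E l k x pos T" "flow_on T c"
  shows "outflow c v = required_outflow (net_inflow c) v"
  using comb_tree_inflow[OF assms, of v] by (simp add: required_outflow_def net_inflow_eq)

text \<open>
  Net inflows determine the inflow and the outflow of every vertex, hence the marginals of the
  transport between consecutive layers; as the tree is non-crossing, this transport is monotone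
  and therefore unique.
\<close>

lemma comb_tree_flow_unique:
  assumes T: "noncrossing_comb_tree E l k x pos T" "noncrossing_comb_tree E l k x pos T'"
    and c: "flow_on T c" "flow_on T' c'" and eq: "net_inflow c = net_inflow c'"
  shows "c = c'"
proof
  fix e :: "'v \<times> 'v"
  have E: "flow_on E c" "flow_on E c'"
    using c T[THEN comb_tree_spanning] by (auto simp: spanning_tree_def intro: flow_on_mono)
  obtain t h where e: "e = (t, h)" by (cases e)
  show "c e = c' e"
  proof (cases "e \<in> E")
    case False
    then show ?thesis using E[THEN flow_on_eq_0] by simp
  next
    case True
    then have lev: "l h = l t + 1" by (simp add: e edge_iff)
    let ?A = "{v. l v = l t}" and ?B = "{v. l v = l h}"
    have row: "(\<Sum>b\<in>?B. d (a, b)) = outflow d a" if "a \<in> ?A" "flow_on E d" for a d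
      unfolding outflow_def using that lev
      by (intro sum.mono_neutral_left) (auto simp: flow_on_def edge_iff)
    have col: "(\<Sum>a\<in>?A. d (a, b)) = inflow d b" if "b \<in> ?B" "flow_on E d" for b d
      unfolding inflow_def using that lev
      by (intro sum.mono_neutral_left) (auto simp: flow_on_def edge_iff)
    have mono: "hpos b \<le> hpos b'"
      if "noncrossing_comb_tree E l k x pos R" "flow_on R d" "b \<in> ?B" "b' \<in> ?B"
        "0 < d (a, b)" "0 < d (a', b')" "hpos a < hpos a'" for R d a b a' b'
    proof -
      have "(a, b) \<in> R" "(a', b') \<in> R" using flow_on_eq_0[OF that(2)] that(5,6) by force+
      then show ?thesis using comb_tree_monotone[OF that(1)] that(3,4,7) by simp
    qed
    have "c (t, h) = c' (t, h)"
    proof (rule monotone_plan_unique[where A = ?A and B = ?B and p = hpos and q = hpos])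
      show "inj_on hpos ?A" "inj_on hpos ?B" by (auto intro!: inj_onI hpos_inj)
      show "0 \<le> c (a, b)" "0 \<le> c' (a, b)" for a b using E by (auto simp: flow_on_def)
      show "(\<Sum>b\<in>?B. c (a, b)) = (\<Sum>b\<in>?B. c' (a, b))" if "a \<in> ?A" for a
        using that row E comb_tree_outflow[OF T(1) c(1)] comb_tree_outflow[OF T(2) c(2)] eq by simp
      show "(\<Sum>a\<in>?A. c (a, b)) = (\<Sum>a\<in>?A. c' (a, b))" if "b \<in> ?B" for b
        using that col E comb_tree_inflow[OF T(1) c(1)] comb_tree_inflow[OF T(2) c(2)] eq by simp
    qed (auto intro: mono[OF T(1) c(1)] mono[OF T(2) c(2)])
    then show ?thesis by (simp add: e)
  qed
qed

text \<open>
  Any flow \<open>c\<close>, on a comb-tree or not, brings at least the positive part of the net inflow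
  into each vertex, so enough of the amount that enters a layer is left for its spine vertex.
\<close>

lemma required_flows_nonneg:
  assumes c: "flow_on E c"
  shows "0 \<le> required_inflow (net_inflow c) v" "0 \<le> required_outflow (net_inflow c) v"
proof -
  let ?y = "net_inflow c"
  have le: "max 0 (?y $ w) \<le> inflow c w" for w
    using inflow_nonneg[OF c, of w] outflow_nonneg[OF c, of w] by (simp add: net_inflow_eq)
  have "inflow c v \<le> required_inflow ?y v \<or> required_inflow ?y v = max 0 (?y $ v)"
    using upper_sum_inflow[OF c, of v] sum_mono[of "{w. l w = l v \<and> w \<notin> spine}", OF le]
    by (simp add: required_inflow_def)
  then show "0 \<le> required_inflow ?y v" "0 \<le> required_outflow ?y v"
    using inflow_nonneg[OF c, of v] outflow_nonneg[OF c, of v]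
    by (auto simp: required_outflow_def net_inflow_eq)
qed

lemma sum_required_inflow:
  assumes "i \<le> k"
  shows "(\<Sum>v | l v = int i. required_inflow y v) = upper_sum y (int i)"
proof -
  let ?r = "x i 0"
  have r: "?r \<in> spine" "l ?r = int i" using assms by (auto simp: spine_def level_first)
  have "(\<Sum>v | l v = int i. required_inflow y v) =
      required_inflow y ?r + (\<Sum>w | l w = l ?r \<and> w \<notin> spine. required_inflow y w)"
    using layer_eq_insert_first[OF r(1)] r by simp
  also have "\<dots> = upper_sum y (int i)"
    using r by (simp add: required_inflow_def)
  finally show ?thesis .
qed

lemma sum_required_outflow:
  assumes "i \<le> k"
  shows "(\<Sum>v | l v = int i. required_outflow y v) = upper_sum y (int i + 1)"
  using sum_required_inflow[OF assms, of y] upper_sum_split[of y "int i"]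
  by (simp add: required_outflow_def sum_subtractf)

lemma required_inflow_bottom:
  assumes c: "flow_on E c" and v: "l v = 0"
  shows "required_inflow (net_inflow c) v = 0"
proof -
  have "inflow c w = 0" if "l w = 0" for w
  proof (rule inflow_eq_0[OF c])
    fix u show "(u, w) \<notin> E" using that level_bounds(1)[of u] by (simp add: edge_iff)
  qed
  then have "(\<Sum>w | l w = 0. required_inflow (net_inflow c) w) = 0"
    using sum_required_inflow[of 0 "net_inflow c"] layer_inflow[OF c, of 0] by simp
  with v show ?thesis using required_flows_nonneg(1)[OF c] by (simp add: sum_nonneg_eq_0_iff)
qed

lemma required_outflow_top:
  assumes c: "flow_on E c" and v: "l v = int k"
  shows "required_outflow (net_inflow c) v = 0"
proof -
  have "{w. int k + 1 \<le> l w} = {}" using level_bounds(2) by (auto simp: not_le intro: le_less_trans)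
  then have "(\<Sum>w | l w = int k. required_outflow (net_inflow c) w) = 0"
    by (simp add: sum_required_outflow upper_sum_def)
  with v show ?thesis using required_flows_nonneg(2)[OF c] by (simp add: sum_nonneg_eq_0_iff)
qed

text \<open>
  The partition of a layer follows the signs of the net inflows, except that the bottom and the top
  layer leave no choice, and that vertices with net inflow 0 may be put on either side. The
  north-west corner rule then transports the required outflows of each layer to the required
  inflows of the next one.
\<close>

lemma comb_tree_through_flow:
  assumes c: "flow_on E c"
  shows "\<exists>T c'. noncrossing_comb_tree E l k x pos T \<and> flow_on T c' \<and> net_inflow c' = net_inflow c"
proof -
  define y where "y = net_inflow c"
  define D where "D i = {v. l v = int i \<and> v \<notin> spine \<and> i \<noteq> 0 \<and> (i = k \<or> 0 \<le> y $ v)}" for i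
  define U where "U i = {v. l v = int i \<and> v \<notin> spine} - D i" for i
  define A where "A i = {x (i - 1) 0} \<union> U (i - 1)" for i
  define B where "B i = {x i 0} \<union> D i" for i
  have lev_A: "l v = int (i - 1)" if "v \<in> A i" "i \<in> {1..k}" for i v
    using that level_first[of "i - 1"] by (auto simp: A_def U_def)
  have lev_B: "l v = int i" if "v \<in> B i" "i \<in> {1..k}" for i v
    using that level_first[of i] by (auto simp: B_def D_def)
  \<comment> \<open>A non-member of \<open>B i\<close> in layer \<open>i\<close> sends flow upwards only, and similarly for \<open>A i\<close>.\<close>
  have in_0: "required_inflow y v = 0" if "l v = int i" "i \<in> {1..k}" "v \<notin> B i" for i v
  proof -
    have "v \<notin> spine" using that(1,3) by (auto simp: spine_iff B_def)
    moreover from this have "y $ v < 0" using that by (auto simp: B_def D_def)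
    ultimately show ?thesis by (simp add: required_inflow_def)
  qed
  have out_0: "required_outflow y v = 0" if "l v = int (i - 1)" "i \<in> {1..k}" "v \<notin> A i" for i v
  proof -
    have "v \<notin> spine" using that(1,3) by (auto simp: spine_iff A_def)
    moreover from this have "0 \<le> y $ v" using that by (auto simp: A_def U_def D_def)
    ultimately show ?thesis by (simp add: required_outflow_def required_inflow_def)
  qed
  define routed where "routed i S d \<longleftrightarrow>
      spanning_tree (A i \<union> B i) (A i \<times> B i) S \<and> monotone_edges hpos S \<and>
      (\<forall>e. 0 \<le> d e) \<and> (\<forall>e. e \<notin> S \<longrightarrow> d e = 0) \<and>
      (\<forall>u\<in>A i. (\<Sum>v\<in>B i. d (u, v)) = required_outflow y u) \<and>
      (\<forall>v\<in>B i. (\<Sum>u\<in>A i. d (u, v)) = required_inflow y v)" for i S and d :: "'v \<times> 'v \<Rightarrow> real"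
  have "\<exists>S d. routed i S d" if i: "i \<in> {1..k}" for i
    unfolding routed_def
  proof (rule northwest_corner_tree)
    show "A i \<inter> B i = {}" using lev_A[OF _ i] lev_B[OF _ i] i by fastforce
    show "inj_on hpos (A i)" "inj_on hpos (B i)"
      using lev_A[OF _ i] lev_B[OF _ i] by (auto intro!: inj_onI hpos_inj)
    show "0 \<le> required_outflow y u" "0 \<le> required_inflow y u" for u
      using required_flows_nonneg[OF c] by (simp_all add: y_def)
    have "sum (required_outflow y) (A i) = (\<Sum>v | l v = int (i - 1). required_outflow y v)"
      using lev_A[OF _ i] out_0[OF _ i] by (intro sum.mono_neutral_left) auto
    also have "\<dots> = upper_sum y (int (i - 1) + 1)"
      using i by (intro sum_required_outflow) auto
    also have "int (i - 1) + 1 = int i" using i by simp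
    also have "upper_sum y (int i) = (\<Sum>v | l v = int i. required_inflow y v)"
      using i by (intro sum_required_inflow[symmetric]) auto
    also have "\<dots> = sum (required_inflow y) (B i)"
      using lev_B[OF _ i] in_0[OF _ i] by (intro sum.mono_neutral_right) auto
    finally show "sum (required_outflow y) (A i) = sum (required_inflow y) (B i)" .
  qed (auto simp: A_def B_def)
  then obtain S d where routed: "\<And>i. i \<in> {1..k} \<Longrightarrow> routed i (S i) (d i)"
    by metis
  then have tree: "i \<in> {1..k} \<Longrightarrow> spanning_tree (A i \<union> B i) (A i \<times> B i) (S i)"
    and mono: "i \<in> {1..k} \<Longrightarrow> monotone_edges hpos (S i)"
    and d_nonneg: "\<And>e. i \<in> {1..k} \<Longrightarrow> 0 \<le> d i e"
    and d_0: "\<And>e. i \<in> {1..k} \<Longrightarrow> e \<notin> S i \<Longrightarrow> d i e = 0"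
    and d_out: "\<And>u. i \<in> {1..k} \<Longrightarrow> u \<in> A i \<Longrightarrow> (\<Sum>v\<in>B i. d i (u, v)) = required_outflow y u"
    and d_in: "\<And>v. i \<in> {1..k} \<Longrightarrow> v \<in> B i \<Longrightarrow> (\<Sum>u\<in>A i. d i (u, v)) = required_inflow y v"
    for i unfolding routed_def by blast+
  have S_sub: "S i \<subseteq> A i \<times> B i" if "i \<in> {1..k}" for i
    using tree[OF that] by (simp add: spanning_tree_def)
  have S_E: "A i \<times> B i \<subseteq> E" if "i \<in> {1..k}" for i
    using lev_A[OF _ that] lev_B[OF _ that] that by (auto simp: edge_iff)
  define T where "T = (\<Union>i\<in>{1..k}. S i)"

  \<comment> \<open>The trees between consecutive layers are glued along the spine, from the bottom up.\<close>
  have "spanning_tree ({v. l v < int n} \<union> {x n 0} \<union> D n) E (\<Union>i\<in>{1..n}. S i)" if "n \<le> k" for n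
    using that
  proof (induction n)
    case 0
    have "{v. l v < int 0} \<union> {x 0 0} \<union> D 0 = {x 0 0}"
      using level_bounds(1) by (auto simp: D_def not_less[symmetric])
    moreover have "(\<Union>i\<in>{1..0}. S i) = {}" by simp
    ultimately show ?case by (simp only: spanning_tree_singleton)
  next
    case (Suc n)
    then have n: "Suc n \<in> {1..k}" "n \<le> k" by auto
    let ?V = "{v. l v < int n} \<union> {x n 0} \<union> D n"
    have "spanning_tree (?V \<union> (A (Suc n) \<union> B (Suc n))) E ((\<Union>i\<in>{1..n}. S i) \<union> S (Suc n))"
    proof (rule spanning_tree_glue[OF asym_E, where r = "x n 0"])
      show "spanning_tree ?V E (\<Union>i\<in>{1..n}. S i)" using Suc by simp
      show "spanning_tree (A (Suc n) \<union> B (Suc n)) E (S (Suc n))"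
        using tree[OF n(1)] S_E[OF n(1)] by (rule spanning_tree_mono)
      have "v \<notin> B (Suc n)" if "v \<in> ?V" for v
        using that lev_B[OF _ n(1), of v] level_first[OF n(2)] by (auto simp: D_def)
      moreover have "v \<notin> U n" if "v \<in> ?V" for v
        using that n(2) spine_def by (auto simp: U_def)
      ultimately show "?V \<inter> (A (Suc n) \<union> B (Suc n)) = {x n 0}"
        by (auto simp: A_def)
    qed
    moreover have "?V \<union> (A (Suc n) \<union> B (Suc n)) =
        {v. l v < int (Suc n)} \<union> {x (Suc n) 0} \<union> D (Suc n)"
    proof -
      have "{v. l v = int n} = {x n 0} \<union> D n \<union> U n"
        using level_first[OF n(2)] by (auto simp: D_def U_def spine_iff)
      moreover have "{v. l v < int (Suc n)} = {v. l v < int n} \<union> {v. l v = int n}" by auto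
      ultimately show ?thesis by (auto simp: A_def B_def)
    qed
    moreover have "(\<Union>i\<in>{1..n}. S i) \<union> S (Suc n) = (\<Union>i\<in>{1..Suc n}. S i)"
      by (auto simp: atLeastAtMostSuc_conv)
    ultimately show ?case by simp
  qed
  from this[of k] have "spanning_tree ({v. l v < int k} \<union> {x k 0} \<union> D k) E T"
    by (simp add: T_def)
  moreover have "v \<in> {v. l v < int k} \<union> {x k 0} \<union> D k" for v
    using level_bounds(2)[of v] k_pos by (auto simp: D_def spine_iff)
  ultimately have "spanning_tree UNIV E T" by (metis UNIV_eq_I)
  moreover have "noncrossing_tree pos ({x (i - 1) 0} \<union> U (i - 1)) ({x i 0} \<union> D i) (S i)"
    if i: "i \<in> {1..k}" for i
  proof -
    have "\<not> edges_cross pos e e'" if e: "e \<in> S i" "e' \<in> S i" for e e'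
    proof -
      obtain t h t' h' where eq: "e = (t, h)" "e' = (t', h')" by (cases e, cases e')
      with e S_sub[OF i] have in_AB: "(t, h) \<in> A i \<times> B i" "(t', h') \<in> A i \<times> B i" by auto
      then have "l h = l h'" using lev_B[OF _ i] by simp
      moreover have "(t, h) \<in> E" "(t', h') \<in> E" using in_AB S_E[OF i] by auto
      ultimately show ?thesis
        using e monotone_edgesD[OF mono[OF i], of t h t' h'] monotone_edgesD[OF mono[OF i], of t' h' t h]
        by (auto simp: eq edges_cross_iff)
    qed
    with tree[OF i] show ?thesis by (simp add: noncrossing_tree_def A_def B_def)
  qed
  moreover have "D i \<union> U i = layer l (int i) - {x i 0} \<and> D i \<inter> U i = {}" if "i \<le> k" for i
    unfolding layer_minus_first by (auto simp: D_def U_def)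
  moreover have "D 0 = {}" "U k = {}" using k_pos by (auto simp: D_def U_def)
  ultimately have comb: "noncrossing_comb_tree E l k x pos T"
    unfolding noncrossing_comb_tree_def
    by (intro conjI exI[of _ D] exI[of _ U] exI[of _ S]) (simp_all add: T_def)

  \<comment> \<open>Every edge takes its amount from the transport into the layer of its head.\<close>
  define c' where "c' e = (if 1 \<le> l (snd e) then d (nat (l (snd e))) e else 0)" for e
  have index: "nat (l v) \<in> {1..k}" if "1 \<le> l v" for v using that level_bounds(2)[of v] by auto
  have c': "flow_on T c'"
  proof -
    have "0 \<le> c' e" for e using d_nonneg[OF index] by (simp add: c'_def)
    moreover have "c' e = 0" if "e \<notin> T" for e
      using that d_0[OF index, of "snd e" e] index[of "snd e"] unfolding c'_def T_def by auto
    ultimately show ?thesis by (auto simp: flow_on_def)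
  qed
  have c'_E: "flow_on E c'"
    using c' comb_tree_spanning[OF comb] by (auto simp: spanning_tree_def intro: flow_on_mono)
  have c'_in: "inflow c' v = required_inflow y v" for v
  proof (cases "l v = 0")
    case True
    then show ?thesis using required_inflow_bottom[OF c True]
      by (simp add: inflow_def c'_def y_def)
  next
    case False
    then have v: "1 \<le> l v" using level_bounds(1)[of v] by simp
    let ?i = "nat (l v)"
    have i: "?i \<in> {1..k}" "l v = int ?i" using index[OF v] v by auto
    have "inflow c' v = (\<Sum>u\<in>UNIV. d ?i (u, v))" using v by (simp add: inflow_def c'_def)
    also have "\<dots> = required_inflow y v"
    proof (cases "v \<in> B ?i")
      case True
      have "(\<Sum>u\<in>UNIV. d ?i (u, v)) = (\<Sum>u\<in>A ?i. d ?i (u, v))"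
        using d_0[OF i(1)] S_sub[OF i(1)] by (intro sum.mono_neutral_right) auto
      then show ?thesis using d_in[OF i(1) True] by simp
    next
      case False
      then have "d ?i (u, v) = 0" for u using d_0[OF i(1)] S_sub[OF i(1)] by auto
      then show ?thesis using in_0[OF i(2,1) False] by simp
    qed
    finally show ?thesis .
  qed
  have c'_out: "outflow c' v = required_outflow y v" for v
  proof (cases "l v = int k")
    case True
    have "(v, w) \<notin> E" for w using True level_bounds(2)[of w] by (simp add: edge_iff)
    then have "outflow c' v = 0" by (rule outflow_eq_0[OF c'_E])
    then show ?thesis using required_outflow_top[OF c True] by (simp add: y_def)
  next
    case False
    let ?i = "nat (l v) + 1"
    have i: "?i \<in> {1..k}" "l v = int (?i - 1)" using False level_bounds[of v] by auto
    have "c' (v, w) = d ?i (v, w)" for w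
    proof (cases "(v, w) \<in> E")
      case True
      then have "1 \<le> l w" "nat (l w) = ?i" using level_bounds(1)[of v] by (auto simp: edge_iff)
      then show ?thesis by (simp add: c'_def)
    next
      case False
      moreover from this have "(v, w) \<notin> S ?i" using S_sub[OF i(1)] S_E[OF i(1)] by blast
      ultimately show ?thesis using d_0[OF i(1)] flow_on_eq_0[OF c'_E] by simp
    qed
    then have "outflow c' v = (\<Sum>w\<in>UNIV. d ?i (v, w))" by (simp add: outflow_def)
    also have "\<dots> = required_outflow y v"
    proof (cases "v \<in> A ?i")
      case True
      have "(\<Sum>w\<in>UNIV. d ?i (v, w)) = (\<Sum>w\<in>B ?i. d ?i (v, w))"
        using d_0[OF i(1)] S_sub[OF i(1)] by (intro sum.mono_neutral_right) auto
      then show ?thesis using d_out[OF i(1) True] by simp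
    next
      case False
      then have "d ?i (v, w) = 0" for w using d_0[OF i(1)] S_sub[OF i(1)] by auto
      then show ?thesis using out_0[OF i(2,1) False] by simp
    qed
    finally show ?thesis .
  qed
  have "net_inflow c' = y"
    by (simp add: vec_eq_iff net_inflow_eq c'_in c'_out required_outflow_def)
  with comb c' show ?thesis unfolding y_def by blast
qed

text \<open>
  Rerouting a flow through a comb-tree preserves its total amount, because all edges climb one
  level and the total is thus a function of the net inflows.
\<close>

lemma comb_trees_cover:
  assumes y: "y \<in> root_polytope E"
  shows "\<exists>T. noncrossing_comb_tree E l k x pos T \<and> y \<in> root_polytope T"
proof -
  obtain c where c: "flow_on E c" "sum c UNIV = 1" "net_inflow c = y"
    using flow_of_root_polytope[OF asym_E y] .
  obtain T c' where T: "noncrossing_comb_tree E l k x pos T"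
    and c': "flow_on T c'" "net_inflow c' = y"
    using comb_tree_through_flow[OF c(1)] c(3) by blast
  have "flow_on E c'"
    using c'(1) comb_tree_spanning[OF T] by (auto simp: spanning_tree_def intro: flow_on_mono)
  then have "sum c' UNIV = 1" using flow_total c c'(2) by metis
  with T c' show ?thesis using net_inflow_in_root_polytope by blast
qed

end

theorem theorem9p6:
  fixes E :: "('v::finite \<times> 'v) set"
    and l :: "'v \<Rightarrow> int"
    and k :: nat
    and s :: "nat \<Rightarrow> nat"
    and x :: "nat \<Rightarrow> nat \<Rightarrow> 'v"
    and pos :: "'v \<Rightarrow> real \<times> real"
  assumes "layer_complete E l"
    and "k \<ge> 1"
    and "{i. layer l i \<noteq> {}} = {0..int k}"
    and "planar_presentation l k s x pos"
  defines "comb_trees \<equiv> {T. noncrossing_comb_tree E l k x pos T}"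
  shows "(\<forall>T\<in>comb_trees. aff_dim (root_polytope E) simplex root_polytope T) \<and>
    (\<forall>T\<in>comb_trees. \<forall>T'\<in>comb_trees. T \<noteq> T' \<longrightarrow>
       (top_of_set (affine hull root_polytope E) interior_of root_polytope T) \<inter>
       (top_of_set (affine hull root_polytope E) interior_of root_polytope T') = {}) \<and>
    (\<Union>T\<in>comb_trees. root_polytope T) = root_polytope E \<and>
    (\<forall>T\<in>comb_trees. \<forall>T'\<in>comb_trees.
       (root_polytope T \<inter> root_polytope T') face_of root_polytope T \<and>
       (root_polytope T \<inter> root_polytope T') face_of root_polytope T')"
proof -
  interpret layer_complete_presentation E l k s x pos
    using assms(1-4) by unfold_locales
  have tree: "spanning_tree UNIV E T" and T_sub: "T \<subseteq> E" and conn: "connected_graph UNIV T"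
    and asym: "asym T"
    if "T \<in> comb_trees" for T
  proof -
    show tree: "spanning_tree UNIV E T" using that by (simp add: comb_trees_def comb_tree_spanning)
    then show "T \<subseteq> E" "connected_graph UNIV T" by (auto simp: spanning_tree_def)
    then show "asym T" using asym_E by (auto intro: asymI dest: asymD)
  qed
  note simplex = root_polytope_tree_simplex[OF asym_E layering_E tree]
  have common: "root_polytope T \<inter> root_polytope T' = root_polytope (T \<inter> T')"
    and face: "(root_polytope T \<inter> root_polytope T') face_of root_polytope T"
    if "T \<in> comb_trees" "T' \<in> comb_trees" for T T'
  proof -
    have "c = c'" if "flow_on T c" "flow_on T' c'" "net_inflow c = net_inflow c'" for c c'
      using comb_tree_flow_unique[OF _ _ that] \<open>T \<in> comb_trees\<close> \<open>T' \<in> comb_trees\<close>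
      by (simp add: comb_trees_def)
    note unique_flows_common_face[OF simplex(1)[OF that(1)] asym[OF that(1)] asym[OF that(2)] this]
    then show "root_polytope T \<inter> root_polytope T' = root_polytope (T \<inter> T')"
      "(root_polytope T \<inter> root_polytope T') face_of root_polytope T" by blast+
  qed
  have disjoint_rel_interiors: "rel_interior (root_polytope T) \<inter> rel_interior (root_polytope T') = {}"
    if T: "T \<in> comb_trees" "T' \<in> comb_trees" "T \<noteq> T'" for T T'
  proof (rule ccontr)
    assume "rel_interior (root_polytope T) \<inter> rel_interior (root_polytope T') \<noteq> {}"
    then obtain z where z: "z \<in> rel_interior (root_polytope T)" "z \<in> rel_interior (root_polytope T')"
      by blast
    then have "z \<in> root_polytope T \<inter> root_polytope T'" using rel_interior_subset by blast
    with z face_of_disjoint_rel_interior[OF face[OF T(1,2)]]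
      face_of_disjoint_rel_interior[OF face[OF T(2,1)]]
    have "root_polytope (T \<inter> T') = root_polytope T" "root_polytope (T \<inter> T') = root_polytope T'"
      using common[OF T(1,2)] by (auto simp: Int_commute)
    then have "T \<inter> T' = T" "T \<inter> T' = T'"
      using root_polytope_full_face[OF simplex(1)[OF T(1)] asym[OF T(1)] Int_lower1]
        root_polytope_full_face[OF simplex(1)[OF T(2)] asym[OF T(2)] Int_lower2] by simp_all
    with T(3) show False by simp
  qed
  have "top_of_set (affine hull root_polytope E) interior_of root_polytope T
      \<subseteq> rel_interior (root_polytope T)" if "T \<in> comb_trees" for T
    using affine_hull_root_polytope_tree[OF layering_E T_sub conn] that
    by (intro interior_of_affine_hull_subset) simp
  with disjoint_rel_interiors have disjoint:
    "(top_of_set (affine hull root_polytope E) interior_of root_polytope T) \<inter>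
     (top_of_set (affine hull root_polytope E) interior_of root_polytope T') = {}"
    if "T \<in> comb_trees" "T' \<in> comb_trees" "T \<noteq> T'" for T T'
    using that by blast
  have cover: "(\<Union>T\<in>comb_trees. root_polytope T) = root_polytope E"
    using comb_trees_cover root_polytope_mono[OF T_sub] unfolding comb_trees_def by blast
  show ?thesis
  proof (intro conjI ballI impI)
    fix T T' assume "T \<in> comb_trees" "T' \<in> comb_trees"
    then show "(root_polytope T \<inter> root_polytope T') face_of root_polytope T'"
      using face[of T' T] by (simp add: Int_commute)
  qed (fact simplex(2) disjoint cover face)+
qed

end
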